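(* For every finite field extension $F/\mathbb{Q}$ of the rationals there is a realizable Delaunay subdivision $T$ (that is, $T\simeq\mathcal{D}(A)$ for some real point configuration $A$) that cannot be realized with coordinates in $F$: no point configuration $A$ with all coordinates in $F$ satisfies $\mathcal{D}(A)\simeq T$. Equivalently, for every finite field extension $F/\mathbb{Q}$ there is an inscribed polytope $P$ that cannot be realized as an inscribed polytope with all vertex coordinates in $F$.
   Context: Point configurations are finite, in some $\mathbb{R}^d$, and labeled by $[n]=\{1,\dots,n\}$. A subdivision of a point configuration $A$ is a collection of polytopes (cells) with vertices in $A$ that covers $\operatorname{conv}(A)$ and such that any two cells meet in a common face. It is identified with a poset of subsets of $[n]$; two subdivisions of labeled configurations are combinatorially equivalent ($\simeq$) if these posets coincide. The Delaunay subdivision $\mathcal{D}(A)$ of $A\subset\mathbb{R}^d$ consists of all cells $C$ for which there is a $(d-1)$-sphere passing through all vertices of $C$ with all other points of $A$ outside this sphere. A realization of $T$ (a Delaunay subdivision of $n$ points in $\mathbb{R}^d$) is a configuration $A$ of $n$ labeled points in $\mathbb{R}^d$ with $\mathcal{D}(A)\simeq T$. A polytope in $\mathbb{R}^d$ is inscribed if all its vertices lie on the unit sphere $\mathbb{S}^{d-1}$. Two vertex-labeled polytopes are combinatorially equivalent if their face lattices (as posets of subsets of $[n]$) coincide; an inscribed realization of $P\subset\mathbb{R}^d$ is an inscribed polytope in $\mathbb{R}^d$ combinatorially equivalent to $P$. The field $F$ is regarded as a subfield of $\mathbb{C}$; coordinates of points are real numbers. *)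

theory Defs
  imports "HOL-Analysis.Analysis" "HOL-Library.Function_Algebras"
begin

text \<open>
  The dimension \<open>d\<close> is quantified existentially in the theorem, so it cannot be a type. As in
  \<^const>\<open>Euclidean_space\<close>, the space of dimension \<open>d\<close> is the set of all \<open>x :: nat \<Rightarrow> real\<close> that
  vanish from index \<open>d\<close> on. The pointwise vector space structure below makes the library's
  \<^const>\<open>convex\<close>, \<^const>\<open>hull\<close> and \<^const>\<open>extreme_point_of\<close> available on these spaces.
  The library's \<^const>\<open>dist\<close> on this function type is not the Euclidean distance and is not used.
\<close>

instantiation "fun" :: (type, real_vector) real_vector
begin

definition scaleR_fun_def: "r *\<^sub>R f = (\<lambda>x. r *\<^sub>R f x)"

instance
  by standard (simp_all add: scaleR_fun_def fun_eq_iff scaleR_add_right scaleR_add_left)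

end

definition coord_space :: "nat \<Rightarrow> (nat \<Rightarrow> real) set" where
  "coord_space d = topspace (Euclidean_space d)"

definition coord_dist :: "nat \<Rightarrow> (nat \<Rightarrow> real) \<Rightarrow> (nat \<Rightarrow> real) \<Rightarrow> real" where
  "coord_dist d x y = L2_set (\<lambda>k. x k - y k) {..<d}"

definition coord_inner :: "nat \<Rightarrow> (nat \<Rightarrow> real) \<Rightarrow> (nat \<Rightarrow> real) \<Rightarrow> real" where
  "coord_inner d x y = (\<Sum>k<d. x k * y k)"

text \<open>Only the values on the label set \<open>{1..n}\<close> matter for a configuration \<open>A\<close>.\<close>

definition point_configuration :: "nat \<Rightarrow> nat \<Rightarrow> (nat \<Rightarrow> nat \<Rightarrow> real) \<Rightarrow> bool" where
  "point_configuration d n A \<longleftrightarrow> A ` {1..n} \<subseteq> coord_space d \<and> inj_on A {1..n}"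

definition vertex_labels :: "nat \<Rightarrow> (nat \<Rightarrow> nat \<Rightarrow> real) \<Rightarrow> (nat \<Rightarrow> real) set \<Rightarrow> nat set" where
  "vertex_labels n A C = {i \<in> {1..n}. A i extreme_point_of C}"

definition delaunay_cells ::
    "nat \<Rightarrow> nat \<Rightarrow> (nat \<Rightarrow> nat \<Rightarrow> real) \<Rightarrow> (nat \<Rightarrow> real) set set" where
  "delaunay_cells d n A =
     {C. (\<exists>S\<subseteq>{1..n}. C = convex hull (A ` S)) \<and>
         (\<exists>c\<in>coord_space d. \<exists>r>0.
            (\<forall>i\<in>vertex_labels n A C. coord_dist d (A i) c = r) \<and>
            (\<forall>i\<in>{1..n} - vertex_labels n A C. coord_dist d (A i) c > r))}"

text \<open>
  A subdivision is identified with its family of vertex label sets. The order is always inclusion,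
  so combinatorial equivalence is equality of these families. The empty cell belongs to every
  Delaunay subdivision in dimension at least one.
\<close>

definition delaunay_subdivision :: "nat \<Rightarrow> nat \<Rightarrow> (nat \<Rightarrow> nat \<Rightarrow> real) \<Rightarrow> nat set set" where
  "delaunay_subdivision d n A = vertex_labels n A ` delaunay_cells d n A"

definition delaunay_realization ::
    "nat \<Rightarrow> nat \<Rightarrow> nat set set \<Rightarrow> (nat \<Rightarrow> nat \<Rightarrow> real) \<Rightarrow> bool" where
  "delaunay_realization d n T A \<longleftrightarrow>
     point_configuration d n A \<and> delaunay_subdivision d n A = T"

text \<open>A vertex-labeled polytope is given by its vertices \<open>v 1, \<dots>, v n\<close>.\<close>

definition labeled_polytope :: "nat \<Rightarrow> nat \<Rightarrow> (nat \<Rightarrow> nat \<Rightarrow> real) \<Rightarrow> bool" where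
  "labeled_polytope d n v \<longleftrightarrow>
     point_configuration d n v \<and>
     (\<forall>i\<in>{1..n}. v i extreme_point_of (convex hull (v ` {1..n})))"

text \<open>
  Faces of a polytope \<open>P\<close> are cut out by linear inequalities valid on \<open>P\<close>, as in
  \<^const>\<open>exposed_face_of\<close>; \<open>a = 0\<close> yields \<open>P\<close> itself and the empty face.
\<close>

definition polytope_faces :: "nat \<Rightarrow> (nat \<Rightarrow> real) set \<Rightarrow> (nat \<Rightarrow> real) set set" where
  "polytope_faces d P =
     {P \<inter> {x. coord_inner d a x = b} | a b.
        a \<in> coord_space d \<and> P \<subseteq> {x. coord_inner d a x \<le> b}}"

definition face_lattice :: "nat \<Rightarrow> nat \<Rightarrow> (nat \<Rightarrow> nat \<Rightarrow> real) \<Rightarrow> nat set set" where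
  "face_lattice d n v = vertex_labels n v ` polytope_faces d (convex hull (v ` {1..n}))"

definition inscribed_polytope :: "nat \<Rightarrow> nat \<Rightarrow> (nat \<Rightarrow> nat \<Rightarrow> real) \<Rightarrow> bool" where
  "inscribed_polytope d n v \<longleftrightarrow>
     labeled_polytope d n v \<and> (\<forall>i\<in>{1..n}. coord_dist d (v i) 0 = 1)"

definition inscribed_realization ::
    "nat \<Rightarrow> nat \<Rightarrow> (nat \<Rightarrow> nat \<Rightarrow> real) \<Rightarrow> (nat \<Rightarrow> nat \<Rightarrow> real) \<Rightarrow> bool" where
  "inscribed_realization d n v w \<longleftrightarrow>
     inscribed_polytope d n w \<and> face_lattice d n w = face_lattice d n v"

lemma vector_space_rat_complex: "vector_space (\<lambda>(q :: rat) (z :: complex). of_rat q * z)"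
  by standard (simp_all add: algebra_simps of_rat_add of_rat_mult)

text \<open>Subfields of the complex numbers that are of finite degree over the rationals.\<close>

definition finite_extension_of_Rats :: "complex set \<Rightarrow> bool" where
  "finite_extension_of_Rats F \<longleftrightarrow>
     0 \<in> F \<and> 1 \<in> F \<and>
     (\<forall>x\<in>F. \<forall>y\<in>F. x + y \<in> F \<and> x * y \<in> F) \<and>
     (\<forall>x\<in>F. - x \<in> F \<and> inverse x \<in> F) \<and>
     (\<exists>B. finite B \<and> F = module.span (\<lambda>(q :: rat) z. of_rat q * z) B)"

definition coordinates_in :: "complex set \<Rightarrow> nat \<Rightarrow> nat \<Rightarrow> (nat \<Rightarrow> nat \<Rightarrow> real) \<Rightarrow> bool" where
  "coordinates_in F d n A \<longleftrightarrow> (\<forall>i\<in>{1..n}. \<forall>k<d. complex_of_real (A i k) \<in> F)"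

end

theory Submission
  imports Defs
begin

text \<open>
  The proof encodes the equation \<open>y ^ m = 2\<close> in the faces of an inscribed polytope. If \<open>m\<close> exceeds the
  degree of \<open>F\<close>, then \<open>F\<close> contains no \<open>m\<close>-th root of 2 (\<open>finite_extension_lacks_root_of_2\<close>). On the
  other hand, finitely many collinearities of points in a projective plane force a cross ratio to
  satisfy this equation (\<open>incidences_force_root_of_2\<close>), and \<open>x = 2 powr (1 / m)\<close> gives a real
  configuration with these collinearities.

  Collinearities are translated into faces by a Lawrence construction. A configuration of vectors
  \<open>a\<^sub>i\<close> is replaced by the pairs of points \<open>(\<plusminus> a\<^sub>i, e\<^sub>i)\<close> with additional coordinate vectors \<open>e\<^sub>i\<close>.
  Rescaling each pair by a positive factor keeps the faces of the hull, so the points can be moved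
  to the unit sphere. The faces record the signs of all numbers \<open>c \<bullet> a\<^sub>i\<close>
  (\<open>lawrence_points_inscribed\<close>). Moreover, for points on the unit sphere the Delaunay subdivision and
  the face lattice agree (\<open>delaunay_subdivision_eq_face_lattice\<close>), so the same points serve both
  claims.

  For the converse, a realization is passed to homogeneous coordinates, after a lift to the
  paraboloid in the case of a Delaunay subdivision. A family of faces then provides supporting
  functionals. A missing face inside of a face is equally informative: if the vectors of a face are
  linearly independent, then its subsets with at least two points are faces as well. So there must be
  a linear dependency, and it can be chosen with coefficients in the field generated by the
  coordinates. In a Lawrence polytope these two facts suffice to find vectors among which the
  relations between the \<open>a\<^sub>i\<close> reappear with coefficients in that field, while independence persists
  (\<open>lawrence_realization_vectors\<close>). Coordinates in \<open>F\<close> would thus yield an \<open>m\<close>-th root of 2 in \<open>F\<close>.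
\<close>

section \<open>Roots of 2 and finite extensions of the rationals\<close>

text \<open>
  Modulo 2 the matrix is unitriangular, so its determinant is odd and cannot vanish. The induction
  replaces the determinant by an elimination of the last column. Cross multiplication with the last
  row keeps the parity pattern, because the last pivot is odd and the rest of that row is even.
\<close>

lemma triangular_mod_2_kernel_trivial:
  fixes M :: "nat \<Rightarrow> nat \<Rightarrow> int" and v :: "nat \<Rightarrow> real"
  assumes "\<And>i. i < m \<Longrightarrow> odd (M i i)"
    and "\<And>i j. j < i \<Longrightarrow> i < m \<Longrightarrow> even (M i j)"
    and "\<And>i. i < m \<Longrightarrow> (\<Sum>j<m. of_int (M i j) * v j) = 0"
    and "i < m"
  shows "v i = 0"
  using assms
proof (induction m arbitrary: M i)
  case 0
  then show ?case by simp
next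
  case (Suc m)
  let ?M' = "\<lambda>i j. M m m * M i j - M i m * M m j"
  have row: "(\<Sum>j<m. of_int (M i j) * v j) + of_int (M i m) * v m = 0" if "i \<le> m" for i
    using Suc.prems(3)[of i] that by simp
  have v: "v i = 0" if "i < m" for i
  proof (rule Suc.IH[of ?M'])
    show "odd (?M' i i)" if "i < m" for i
      using that Suc.prems(1)[of i] Suc.prems(1)[of m] Suc.prems(2)[of i m] by simp
    show "even (?M' i j)" if "j < i" "i < m" for i j
      using that Suc.prems(2)[of j i] Suc.prems(2)[of j m] by simp
    show "(\<Sum>j<m. of_int (?M' i j) * v j) = 0" if "i < m" for i
    proof -
      have "(\<Sum>j<m. of_int (?M' i j) * v j) =
          of_int (M m m) * (\<Sum>j<m. of_int (M i j) * v j) - of_int (M i m) * (\<Sum>j<m. of_int (M m j) * v j)"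
        by (simp add: sum_distrib_left sum_subtractf algebra_simps)
      also have "\<dots> = of_int (M m m) * (- of_int (M i m) * v m) - of_int (M i m) * (- of_int (M m m) * v m)"
        using row[of i] row[of m] that by (simp add: add_eq_0_iff)
      finally show ?thesis by simp
    qed
  qed fact
  show ?case
  proof (cases "i < m")
    case True
    then show ?thesis by (rule v)
  next
    case False
    have "M m m \<noteq> 0" using Suc.prems(1)[of m] by auto
    then have "v m = 0" using row[of m] v by simp
    with False Suc.prems(4) show ?thesis by (simp add: less_Suc_eq)
  qed
qed

text \<open>
  Multiplying the relation by \<open>y ^ r\<close> and reducing with \<open>y ^ m = 2\<close> gives one relation for each
  \<open>r < m\<close>. Every reduction contributes a factor 2, and it concerns exactly the entries below the
  diagonal, while the diagonal entries are all \<open>a 0\<close>. The vector of powers of \<open>y\<close> lies in the kernel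
  of this matrix, which has to be trivial if \<open>a 0\<close> is odd.
\<close>

lemma relation_constant_term_even:
  fixes a :: "nat \<Rightarrow> int" and y :: real
  assumes y: "y ^ m = 2" and "0 < m" and rel: "(\<Sum>i<m. of_int (a i) * y ^ i) = 0"
  shows "even (a 0)"
proof (rule ccontr)
  assume odd: "odd (a 0)"
  define M where "M r j = (if r \<le> j then a (j - r) else 2 * a (m + j - r))" for r j
  have "y ^ 0 = 0"
  proof (rule triangular_mod_2_kernel_trivial[where M = M and v = "\<lambda>j. y ^ j" and m = m])
    fix r assume "r < m"
    have "(\<Sum>j<m. of_int (M r j) * y ^ j)
        = (\<Sum>j\<in>{..<r}. of_int (M r j) * y ^ j) + (\<Sum>j\<in>{r..<m}. of_int (M r j) * y ^ j)"
      using \<open>r < m\<close> by (subst sum.union_disjoint[symmetric]) (auto intro: sum.cong)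
    also have "(\<Sum>j\<in>{..<r}. of_int (M r j) * y ^ j) = (\<Sum>i\<in>{m-r..<m}. y ^ r * (of_int (a i) * y ^ i))"
    proof (rule sum.reindex_bij_witness[where i = "\<lambda>i. i - (m - r)" and j = "\<lambda>j. j + (m - r)"])
      fix j assume j: "j \<in> {..<r}"
      have "y ^ r * y ^ (j + (m - r)) = y ^ (m + j)"
        using \<open>r < m\<close> by (simp add: power_add[symmetric] add.commute)
      then show "y ^ r * (of_int (a (j + (m - r))) * y ^ (j + (m - r))) = of_int (M r j) * y ^ j"
        using j \<open>r < m\<close> y by (simp add: M_def power_add mult.left_commute[of "y ^ r"] add.commute)
    qed (use \<open>r < m\<close> in auto)
    also have "(\<Sum>j\<in>{r..<m}. of_int (M r j) * y ^ j) = (\<Sum>i\<in>{..<m-r}. y ^ r * (of_int (a i) * y ^ i))"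
      by (rule sum.reindex_bij_witness[where i = "\<lambda>i. i + r" and j = "\<lambda>j. j - r"])
        (auto simp: M_def power_add[symmetric])
    also have "(\<Sum>i\<in>{m-r..<m}. y ^ r * (of_int (a i) * y ^ i)) + (\<Sum>i\<in>{..<m-r}. y ^ r * (of_int (a i) * y ^ i))
        = (\<Sum>i<m. y ^ r * (of_int (a i) * y ^ i))"
      by (subst sum.union_disjoint[symmetric]) (auto intro!: sum.cong)
    finally show "(\<Sum>j<m. of_int (M r j) * y ^ j) = 0"
      using rel by (simp add: sum_distrib_left[symmetric])
  qed (use odd \<open>0 < m\<close> in \<open>auto simp: M_def\<close>)
  then show False by simp
qed

text \<open>
  If the coefficients below \<open>j\<close> are even, then dividing the relation by \<open>y ^ j\<close> and replacing
  \<open>1 / y ^ i\<close> by \<open>y ^ (m - i) / 2\<close> produces another integral relation, with constant term \<open>a j\<close>.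
\<close>

lemma relation_coefficients_even:
  fixes a :: "nat \<Rightarrow> int" and y :: real
  assumes y: "y ^ m = 2" and rel: "(\<Sum>i<m. of_int (a i) * y ^ i) = 0" and "j < m"
  shows "even (a j)"
  using \<open>j < m\<close>
proof (induction j rule: less_induct)
  case (less j)
  have y0: "y \<noteq> 0" using y \<open>j < m\<close> by (auto simp: power_0_left)
  define b where "b i = (if i + j < m then a (i + j) else a (i + j - m) div 2)" for i
  have "even (b 0)"
  proof (rule relation_constant_term_even[OF y])
    have "y ^ j * (\<Sum>i<m. of_int (b i) * y ^ i) = (\<Sum>i<m. of_int (b i) * y ^ (i + j))"
      by (simp add: sum_distrib_left power_add mult_ac)
    also have "\<dots> = (\<Sum>i\<in>{..<m-j}. of_int (b i) * y ^ (i + j)) + (\<Sum>i\<in>{m-j..<m}. of_int (b i) * y ^ (i + j))"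
      by (subst sum.union_disjoint[symmetric]) (auto intro!: sum.cong)
    also have "(\<Sum>i\<in>{..<m-j}. of_int (b i) * y ^ (i + j)) = (\<Sum>i\<in>{j..<m}. of_int (a i) * y ^ i)"
      by (rule sum.reindex_bij_witness[where i = "\<lambda>i. i - j" and j = "\<lambda>i. i + j"]) (auto simp: b_def)
    also have "(\<Sum>i\<in>{m-j..<m}. of_int (b i) * y ^ (i + j)) = (\<Sum>i\<in>{..<j}. of_int (a i) * y ^ i)"
    proof (rule sum.reindex_bij_witness[where i = "\<lambda>i. i + (m - j)" and j = "\<lambda>i. i - (m - j)"])
      fix i assume i: "i \<in> {m-j..<m}"
      then obtain k where k: "i = k + (m - j)" "k < j" using less.prems
        by (metis add.commute add_diff_inverse_nat atLeastLessThan_iff diff_diff_cancel le_add_diff_inverse2 less_diff_conv2 less_or_eq_imp_le not_less)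
      have "even (a k)" using less.IH[of k] k less.prems by simp
      then have "2 * real_of_int (a k div 2) = of_int (a k)"
        by (metis dvd_mult_div_cancel of_int_mult of_int_numeral)
      moreover have "i + j = m + k" using k less.prems by simp
      ultimately show "of_int (a (i - (m - j))) * y ^ (i - (m - j)) = of_int (b i) * y ^ (i + j)"
        using k less.prems y by (simp add: b_def power_add)
    qed (use less.prems in auto)
    also have "(\<Sum>i\<in>{j..<m}. of_int (a i) * y ^ i) + (\<Sum>i\<in>{..<j}. of_int (a i) * y ^ i)
        = (\<Sum>i<m. of_int (a i) * y ^ i)"
      using less.prems by (subst sum.union_disjoint[symmetric]) (auto intro!: sum.cong)
    finally show "(\<Sum>i<m. of_int (b i) * y ^ i) = 0" using rel y0 by simp
  qed (use less.prems in simp)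
  then show ?case using less.prems by (simp add: b_def)
qed

text \<open>
  The coefficients of a relation are even and half of a relation is again a relation. Hence every
  power of 2 divides every coefficient.
\<close>

lemma integer_relation_trivial:
  fixes a :: "nat \<Rightarrow> int" and y :: real
  assumes y: "y ^ m = 2" and rel: "(\<Sum>i<m. of_int (a i) * y ^ i) = 0" and "j < m"
  shows "a j = 0"
proof -
  have "\<forall>a. (\<Sum>i<m. of_int (a i) * y ^ i) = 0 \<longrightarrow> 2 ^ s dvd a j" for s
  proof (induction s)
    case (Suc s)
    show ?case
    proof (intro allI impI)
      fix a :: "nat \<Rightarrow> int" assume a: "(\<Sum>i<m. of_int (a i) * y ^ i) = 0"
      have ev: "a i = 2 * (a i div 2)" if "i < m" for i
        using relation_coefficients_even[OF y a that] by simp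
      have "(\<Sum>i<m. of_int (a i) * y ^ i) = (\<Sum>i<m. 2 * (of_int (a i div 2) * y ^ i))"
        by (rule sum.cong[OF refl], subst ev) auto
      then have "(\<Sum>i<m. of_int (a i div 2) * y ^ i) = 0"
        using a by (simp add: sum_distrib_left[symmetric])
      then have "2 ^ s dvd a j div 2" using Suc.IH[THEN spec, of "\<lambda>i. a i div 2"] by simp
      then show "2 ^ Suc s dvd a j" using ev[OF \<open>j < m\<close>]
        by (metis mult_dvd_mono dvd_refl power_Suc)
    qed
  qed simp
  then have dvd: "2 ^ s dvd a j" for s using rel by blast
  show ?thesis
  proof (rule ccontr)
    assume "a j \<noteq> 0"
    then have "2 ^ nat \<bar>a j\<bar> \<le> \<bar>a j\<bar>" using dvd[of "nat \<bar>a j\<bar>"]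
      by (metis dvd_imp_le_int abs_numeral power_abs)
    moreover have "\<bar>a j\<bar> < 2 ^ nat \<bar>a j\<bar>"
      using of_nat_less_two_power[of "nat \<bar>a j\<bar>", where 'a = int] by simp
    ultimately show False by simp
  qed
qed

lemma rational_relation_trivial:
  fixes q :: "nat \<Rightarrow> rat" and y :: real
  assumes y: "y ^ m = 2" and rel: "(\<Sum>i<m. of_rat (q i) * y ^ i) = 0" and "j < m"
  shows "q j = 0"
proof -
  define \<Delta> where "\<Delta> = (\<Prod>i<m. snd (quotient_of (q i)))"
  have pos: "snd (quotient_of r) > 0" for r by (rule quotient_of_denom_pos')
  have "\<Delta> > 0" unfolding \<Delta>_def by (rule prod_pos) (simp add: pos)
  have int: "\<exists>z::int. of_int \<Delta> * q i = of_int z" if "i < m" for i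
  proof -
    have "\<Delta> = snd (quotient_of (q i)) * (\<Prod>j\<in>{..<m}-{i}. snd (quotient_of (q j)))"
      unfolding \<Delta>_def using that by (subst prod.remove[of _ i]) auto
    moreover have "q i = of_int (fst (quotient_of (q i))) / of_int (snd (quotient_of (q i)))"
      by (metis quotient_of_div prod.collapse)
    then have "of_int (snd (quotient_of (q i))) * q i = of_int (fst (quotient_of (q i)))"
      using pos[of "q i"] by (metis less_irrefl nonzero_mult_div_cancel_left of_int_eq_0_iff times_divide_eq_right)
    ultimately show ?thesis
      by (metis (no_types, lifting) mult.assoc mult.commute of_int_mult)
  qed
  define a where "a i = (SOME z. of_int \<Delta> * q i = of_int z)" for i
  have a: "of_int \<Delta> * q i = of_int (a i)" if "i < m" for i
    unfolding a_def using someI_ex[OF int[OF that]] .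
  have "(\<Sum>i<m. of_int (a i) * y ^ i) = (\<Sum>i<m. of_int \<Delta> * (of_rat (q i) * y ^ i))"
  proof (rule sum.cong[OF refl])
    fix i assume "i \<in> {..<m}"
    then have "(of_rat (of_int \<Delta> * q i) :: real) = of_rat (of_int (a i))" using a by simp
    then have "real_of_int (a i) = of_int \<Delta> * of_rat (q i)" by (simp add: of_rat_mult)
    then show "of_int (a i) * y ^ i = of_int \<Delta> * (of_rat (q i) * y ^ i)" by simp
  qed
  then have "(\<Sum>i<m. of_int (a i) * y ^ i) = 0"
    using rel by (simp add: sum_distrib_left[symmetric])
  then have "a j = 0" using integer_relation_trivial[OF y] \<open>j < m\<close> by blast
  then show ?thesis using a[OF \<open>j < m\<close>] \<open>\<Delta> > 0\<close> by simp
qed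

lemma complex_of_rat_eq: "(of_rat q :: complex) = of_real (of_rat q)"
  by (cases q) (simp add: of_rat_rat)

text \<open>
  Any \<open>m\<close> above the degree of \<open>F\<close> will do: an \<open>m\<close>-th root \<open>y\<close> of 2 in \<open>F\<close> would contribute the
  \<open>m\<close> independent elements \<open>1, y, \<dots>, y ^ (m - 1)\<close>.
\<close>

lemma finite_extension_lacks_root_of_2:
  assumes "finite_extension_of_Rats F"
  obtains m where "0 < m" "\<And>y :: real. y ^ m = 2 \<Longrightarrow> complex_of_real y \<notin> F"
proof -
  interpret Q: vector_space "\<lambda>(q :: rat) (z :: complex). of_rat q * z"
    by (rule vector_space_rat_complex)
  from assms obtain B where B: "finite B" "F = Q.span B" and
    one: "1 \<in> F" and mult: "\<And>x y. x \<in> F \<Longrightarrow> y \<in> F \<Longrightarrow> x * y \<in> F"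
    unfolding finite_extension_of_Rats_def by blast
  show thesis
  proof (rule that[of "Suc (card B)"])
    fix y :: real assume y: "y ^ Suc (card B) = 2"
    let ?m = "Suc (card B)" and ?p = "\<lambda>i. complex_of_real y ^ i"
    show "complex_of_real y \<notin> F"
    proof
      assume "complex_of_real y \<in> F"
      then have pow: "?p i \<in> F" for i by (induction i) (auto intro: one mult)
      have inj: "inj_on ?p {..<?m}"
      proof (rule inj_onI)
        fix i j assume ij: "i \<in> {..<?m}" "j \<in> {..<?m}" "?p i = ?p j"
        then have eq: "y ^ i = y ^ j" by (metis of_real_eq_iff of_real_power)
        define q :: "nat \<Rightarrow> rat" where "q l = (if l = i then 1 else 0) - (if l = j then 1 else 0)" for l
        have "(\<Sum>l<?m. of_rat (q l) * y ^ l) = 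
            (\<Sum>l<?m. (if l = i then y ^ l else 0) - (if l = j then y ^ l else 0))"
          by (rule sum.cong) (auto simp: q_def of_rat_diff)
        also have "\<dots> = 0" using ij eq by (simp add: sum_subtractf sum.delta del: sum.lessThan_Suc)
        finally have "q i = 0" using rational_relation_trivial[OF y] ij by blast
        then show "i = j" by (auto simp: q_def split: if_splits)
      qed
      have "Q.independent (?p ` {..<?m})"
      proof (rule Q.independent_if_scalars_zero)
        fix f x assume f: "(\<Sum>x\<in>?p ` {..<?m}. of_rat (f x) * x) = 0" and x: "x \<in> ?p ` {..<?m}"
        have "complex_of_real (\<Sum>i<?m. of_rat (f (?p i)) * y ^ i) = (\<Sum>x\<in>?p ` {..<?m}. of_rat (f x) * x)"
          by (subst sum.reindex[OF inj]) (simp add: o_def complex_of_rat_eq del: sum.lessThan_Suc)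
        with f have "(\<Sum>i<?m. of_rat (f (?p i)) * y ^ i) = 0" by (metis of_real_eq_0_iff)
        then show "f x = 0" using rational_relation_trivial[OF y, of "\<lambda>i. f (?p i)"] x by blast
      qed simp
      moreover have "?p ` {..<?m} \<subseteq> Q.span B" using pow B by blast
      ultimately have "card (?p ` {..<?m}) \<le> card B" using Q.independent_span_bound[OF B(1)] by blast
      then show False by (simp add: card_image[OF inj] del: lessThan_Suc)
    qed
  qed simp
qed

section \<open>Empty spheres and supporting hyperplanes\<close>

lemma coord_space_iff: "x \<in> coord_space d \<longleftrightarrow> (\<forall>k\<ge>d. x k = 0)"
  by (simp add: coord_space_def topspace_Euclidean_space)

lemma coord_inner_commute: "coord_inner d x y = coord_inner d y x"
  by (simp add: coord_inner_def mult.commute)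

lemma linear_coord_inner: "linear (coord_inner d a)"
  by (rule linearI) (simp_all add: coord_inner_def scaleR_fun_def algebra_simps sum.distrib sum_distrib_left)

lemma coord_inner_nonneg: "0 \<le> coord_inner d x x"
  by (simp add: coord_inner_def sum_nonneg)

lemma coord_dist_eq_0_iff:
  assumes "x \<in> coord_space d" "y \<in> coord_space d"
  shows "coord_dist d x y = 0 \<longleftrightarrow> x = y"
proof
  assume "coord_dist d x y = 0"
  then have "x k = y k" if "k < d" for k
    using that by (simp add: coord_dist_def L2_set_eq_0_iff)
  then show "x = y" using assms by (metis coord_space_iff ext not_le)
qed (simp add: coord_dist_def L2_set_def)

lemma coord_dist_nonneg: "0 \<le> coord_dist d x y"
  by (simp add: coord_dist_def L2_set_nonneg)

lemma coord_dist_square: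
  "(coord_dist d x y)\<^sup>2 = coord_inner d x x - 2 * coord_inner d x y + coord_inner d y y"
proof -
  have "(coord_dist d x y)\<^sup>2 = (\<Sum>k<d. (x k - y k)\<^sup>2)"
    by (simp add: coord_dist_def L2_set_def sum_nonneg)
  then show ?thesis
    by (simp add: coord_inner_def power2_eq_square algebra_simps sum.distrib sum_subtractf sum_distrib_left)
qed

text \<open>
  The open halfspace \<open>f < f u\<close> together with the boundary point \<open>u\<close> is convex, so it contains the
  hull, and on the hull \<open>f\<close> attains the value \<open>f u\<close> at \<open>u\<close> only.
\<close>

lemma strict_maximum_imp_extreme_point:
  fixes f :: "'a::real_vector \<Rightarrow> real"
  assumes lin: "linear f" and u: "u \<in> S" and max: "\<And>v. v \<in> S \<Longrightarrow> v \<noteq> u \<Longrightarrow> f v < f u"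
  shows "u extreme_point_of (convex hull S)"
proof -
  have "convex {x. f x < f u \<or> x = u}"
  proof (rule convexI)
    fix x y s t assume x: "x \<in> {x. f x < f u \<or> x = u}" and y: "y \<in> {x. f x < f u \<or> x = u}"
      and st: "0 \<le> (s::real)" "0 \<le> t" "s + t = 1"
    have f: "f (s *\<^sub>R x + t *\<^sub>R y) = s * f x + t * f y"
      using lin by (simp add: linear_add linear_scale)
    have "s * f x + t * f y < f u \<or> s *\<^sub>R x + t *\<^sub>R y = u"
    proof (cases "s = 0 \<or> t = 0 \<or> (x = u \<and> y = u)")
      case True
      then show ?thesis using x y st by (auto simp: scaleR_left_distrib[symmetric])
    next
      case False
      then have "s > 0" "t > 0" using st by auto
      have "s * f x + t * f y < s * f u + t * f u"
      proof (cases "x = u")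
        case True
        then show ?thesis using False y \<open>t > 0\<close> by auto
      next
        case False
        then show ?thesis using x y \<open>s > 0\<close> \<open>t > 0\<close>
          by (intro add_less_le_mono) auto
      qed
      then show ?thesis using st by (metis distrib_right mult_1)
    qed
    then show "s *\<^sub>R x + t *\<^sub>R y \<in> {x. f x < f u \<or> x = u}" using f by simp
  qed
  then have "convex hull S \<subseteq> {x. f x < f u \<or> x = u}"
    using max by (intro hull_minimal) auto
  then have le: "f x < f u \<or> x = u" if "x \<in> convex hull S" for x
    using that by blast
  show ?thesis
    unfolding extreme_point_of_def
  proof (intro conjI ballI notI)
    show "u \<in> convex hull S" using u by (rule hull_inc)
    fix p q assume pq: "p \<in> convex hull S" "q \<in> convex hull S" and "u \<in> open_segment p q"
    then obtain t where t: "0 < t" "t < 1" "u = (1 - t) *\<^sub>R p + t *\<^sub>R q" and ne: "p \<noteq> q"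
      by (auto simp: in_segment)
    have "f u = (1 - t) * f p + t * f q"
      using lin t(3) by (simp add: linear_add linear_scale)
    moreover have "(1 - t) * f p + t * f q < (1 - t) * f u + t * f u"
    proof (cases "p = u")
      case True
      then have "f q < f u" using le[OF pq(2)] ne by auto
      then show ?thesis using True t(1,2) by simp
    next
      case False
      then have "f p < f u" "f q \<le> f u" using le[OF pq(1)] le[OF pq(2)] by auto
      then show ?thesis using t(1,2) by (intro add_less_le_mono) auto
    qed
    ultimately show False by (simp add: algebra_simps)
  qed
qed

text \<open>
  A point \<open>p\<close> of a sphere with centre \<open>c\<close> is the strict maximum over the sphere of the inner product
  with \<open>p - c\<close>. So all points on an empty sphere are vertices of their hull, and the cells may be
  replaced by the sets of points on empty spheres.
\<close>

lemma delaunay_subdivision_iff: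
  assumes A: "point_configuration d n A"
  shows "S \<in> delaunay_subdivision d n A \<longleftrightarrow> S \<subseteq> {1..n} \<and>
    (\<exists>c\<in>coord_space d. \<exists>r>0. (\<forall>i\<in>S. coord_dist d (A i) c = r) \<and>
       (\<forall>i\<in>{1..n} - S. coord_dist d (A i) c > r))" (is "_ \<longleftrightarrow> ?R")
proof
  assume "S \<in> delaunay_subdivision d n A"
  then show ?R
    by (auto simp: delaunay_subdivision_def delaunay_cells_def) (auto simp: vertex_labels_def)
next
  assume ?R
  then obtain c r where S: "S \<subseteq> {1..n}" and c: "c \<in> coord_space d" and r: "r > 0"
    and on: "\<And>i. i \<in> S \<Longrightarrow> coord_dist d (A i) c = r"
    and off: "\<And>i. i \<in> {1..n} - S \<Longrightarrow> coord_dist d (A i) c > r" by blast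
  have inj: "inj_on A {1..n}" and sp: "\<And>i. i \<in> {1..n} \<Longrightarrow> A i \<in> coord_space d"
    using A by (auto simp: point_configuration_def)
  have V: "vertex_labels n A (convex hull (A ` S)) = S"
  proof (intro equalityI subsetI)
    fix i assume "i \<in> vertex_labels n A (convex hull (A ` S))"
    then have "i \<in> {1..n}" "A i \<in> A ` S"
      by (auto simp: vertex_labels_def dest: extreme_point_of_convex_hull)
    then show "i \<in> S" using inj S by (meson inj_on_image_mem_iff)
  next
    fix i assume i: "i \<in> S"
    have "A i extreme_point_of (convex hull (A ` S))"
    proof (rule strict_maximum_imp_extreme_point)
      let ?f = "coord_inner d (A i - c)"
      show "linear ?f" by (rule linear_coord_inner)
      fix v assume "v \<in> A ` S" "v \<noteq> A i"
      then obtain j where j: "j \<in> S" "v = A j" "A j \<noteq> A i" by auto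
      have lin: "coord_inner d (x - c) y = coord_inner d x y - coord_inner d c y" for x y
        by (simp add: coord_inner_def algebra_simps sum_subtractf)
      have "coord_dist d (A i) (A j) > 0"
        using coord_dist_eq_0_iff[of "A i" d "A j"] sp i j S coord_dist_nonneg[of d "A i" "A j"] by force
      then have "(coord_dist d (A i) (A j))\<^sup>2 > 0" by simp
      moreover have "(coord_dist d (A i) c)\<^sup>2 = (coord_dist d (A j) c)\<^sup>2"
        using on i j by simp
      ultimately show "?f v < ?f (A i)"
        unfolding coord_dist_square lin j(2)
        using coord_inner_commute[of d c "A i"] coord_inner_commute[of d c "A j"]
            coord_inner_commute[of d "A i" "A j"] by simp
    qed (use i in auto)
    then show "i \<in> vertex_labels n A (convex hull (A ` S))"
      using i S by (auto simp: vertex_labels_def)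
  qed
  have "\<exists>c\<in>coord_space d. \<exists>r>0. (\<forall>i\<in>S. coord_dist d (A i) c = r) \<and>
       (\<forall>i\<in>{1..n} - S. coord_dist d (A i) c > r)"
    using c r on off by blast
  then have "convex hull (A ` S) \<in> delaunay_cells d n A"
    unfolding delaunay_cells_def mem_Collect_eq V using S by blast
  then show "S \<in> delaunay_subdivision d n A"
    unfolding delaunay_subdivision_def 
    by (rule image_eqI[where x = "convex hull (A ` S)" and f = "vertex_labels n A", OF V[symmetric]])
qed

text \<open>
  In terms of a sphere with centre \<open>c\<close> and radius \<open>r\<close>, the number \<open>s\<close> is \<open>r\<^sup>2 - \<parallel>c\<parallel>\<^sup>2\<close>, and the
  inequality on \<open>s\<close> says \<open>r > 0\<close>. In this form the condition is affine in the point \<open>(x, \<parallel>x\<parallel>\<^sup>2)\<close> of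
  the paraboloid.
\<close>

lemma delaunay_subdivision_power_iff:
  assumes A: "point_configuration d n A"
  shows "S \<in> delaunay_subdivision d n A \<longleftrightarrow> S \<subseteq> {1..n} \<and>
    (\<exists>c\<in>coord_space d. \<exists>s. s + coord_inner d c c > 0 \<and>
       (\<forall>i\<in>S. coord_inner d (A i) (A i) - 2 * coord_inner d (A i) c = s) \<and>
       (\<forall>i\<in>{1..n} - S. coord_inner d (A i) (A i) - 2 * coord_inner d (A i) c > s))"
    (is "_ \<longleftrightarrow> _ \<and> ?R")
proof -
  have sq: "coord_dist d x c = r \<longleftrightarrow> coord_inner d x x - 2 * coord_inner d x c = r\<^sup>2 - coord_inner d c c"
    "coord_dist d x c > r \<longleftrightarrow> coord_inner d x x - 2 * coord_inner d x c > r\<^sup>2 - coord_inner d c c"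
    if "r > 0" for x c r
  proof -
    have "coord_dist d x c = r \<longleftrightarrow> (coord_dist d x c)\<^sup>2 = r\<^sup>2"
      using that coord_dist_nonneg[of d x c] by auto
    then show "coord_dist d x c = r \<longleftrightarrow> coord_inner d x x - 2 * coord_inner d x c = r\<^sup>2 - coord_inner d c c"
      unfolding coord_dist_square by linarith
    have "coord_dist d x c > r \<longleftrightarrow> (coord_dist d x c)\<^sup>2 > r\<^sup>2"
      using that coord_dist_nonneg[of d x c] power_mono_iff[of "coord_dist d x c" r 2] by linarith
    then show "coord_dist d x c > r \<longleftrightarrow> coord_inner d x x - 2 * coord_inner d x c > r\<^sup>2 - coord_inner d c c"
      unfolding coord_dist_square by linarith
  qed
  have "(\<exists>c\<in>coord_space d. \<exists>r>0. (\<forall>i\<in>S. coord_dist d (A i) c = r) \<and>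
       (\<forall>i\<in>{1..n} - S. coord_dist d (A i) c > r)) \<longleftrightarrow> ?R"
  proof
    assume "\<exists>c\<in>coord_space d. \<exists>r>0. (\<forall>i\<in>S. coord_dist d (A i) c = r) \<and>
       (\<forall>i\<in>{1..n} - S. coord_dist d (A i) c > r)"
    then obtain c r where c: "c \<in> coord_space d" "r > 0" "\<forall>i\<in>S. coord_dist d (A i) c = r"
       "\<forall>i\<in>{1..n} - S. coord_dist d (A i) c > r" by blast
    have "(r\<^sup>2 - coord_inner d c c) + coord_inner d c c > 0 \<and>
       (\<forall>i\<in>S. coord_inner d (A i) (A i) - 2 * coord_inner d (A i) c = r\<^sup>2 - coord_inner d c c) \<and>
       (\<forall>i\<in>{1..n} - S. coord_inner d (A i) (A i) - 2 * coord_inner d (A i) c > r\<^sup>2 - coord_inner d c c)"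
      using c(2-4) unfolding sq[OF c(2)] by simp
    then show ?R using c(1) by blast
  next
    assume ?R
    then obtain c s where c: "c \<in> coord_space d" "s + coord_inner d c c > 0"
      "\<forall>i\<in>S. coord_inner d (A i) (A i) - 2 * coord_inner d (A i) c = s"
      "\<forall>i\<in>{1..n} - S. coord_inner d (A i) (A i) - 2 * coord_inner d (A i) c > s" by blast
    define r where "r = sqrt (s + coord_inner d c c)"
    have "r > 0" and s: "r\<^sup>2 - coord_inner d c c = s" using c(2) by (auto simp: r_def)
    have "(\<forall>i\<in>S. coord_dist d (A i) c = r) \<and> (\<forall>i\<in>{1..n} - S. coord_dist d (A i) c > r)"
      unfolding sq[OF \<open>r > 0\<close>] s using c(3,4) by blast
    then show "\<exists>c\<in>coord_space d. \<exists>r>0. (\<forall>i\<in>S. coord_dist d (A i) c = r) \<and>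
       (\<forall>i\<in>{1..n} - S. coord_dist d (A i) c > r)"
      using c(1) \<open>r > 0\<close> by blast
  qed
  then show ?thesis by (simp only: delaunay_subdivision_iff[OF A])
qed

lemma delaunay_subdivision_powerI:
  assumes "point_configuration d n A" "S \<subseteq> {1..n}" "c \<in> coord_space d" "s + coord_inner d c c > 0"
    and "\<And>i. i \<in> S \<Longrightarrow> coord_inner d (A i) (A i) - 2 * coord_inner d (A i) c = s"
    and "\<And>i. i \<in> {1..n} - S \<Longrightarrow> coord_inner d (A i) (A i) - 2 * coord_inner d (A i) c > s"
  shows "S \<in> delaunay_subdivision d n A"
  unfolding delaunay_subdivision_power_iff[OF assms(1)] using assms(2-)
  by (intro conjI bexI[of _ c] exI[of _ s] ballI)

text \<open>
  A vertex of a polytope that lies in a face is a vertex of this face, so the label set of a face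
  consists of the points at which its linear inequality is tight.
\<close>

lemma face_lattice_iff:
  assumes w: "labeled_polytope d n w"
  shows "S \<in> face_lattice d n w \<longleftrightarrow> S \<subseteq> {1..n} \<and>
    (\<exists>a\<in>coord_space d. \<exists>b. (\<forall>i\<in>S. coord_inner d a (w i) = b) \<and>
       (\<forall>i\<in>{1..n} - S. coord_inner d a (w i) < b))"
proof -
  let ?P = "convex hull (w ` {1..n})"
  have ext: "w i extreme_point_of ?P" if "i \<in> {1..n}" for i
    using w that by (auto simp: labeled_polytope_def)
  have halfspace: "?P \<subseteq> {x. coord_inner d a x \<le> b} \<longleftrightarrow> (\<forall>i\<in>{1..n}. coord_inner d a (w i) \<le> b)" for a b
  proof -
    have "convex {x. coord_inner d a x \<le> b}"
      using convex_linear_vimage[OF linear_coord_inner, of "{..b}" d a]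
      by (simp add: vimage_def convex_real_interval)
    then have "?P \<subseteq> {x. coord_inner d a x \<le> b} \<longleftrightarrow> w ` {1..n} \<subseteq> {x. coord_inner d a x \<le> b}"
      by (rule subset_hull)
    then show ?thesis by auto
  qed
  have labels: "vertex_labels n w (?P \<inter> {x. coord_inner d a x = b}) = {i\<in>{1..n}. coord_inner d a (w i) = b}" for a b
    using ext by (auto simp: vertex_labels_def extreme_point_of_def)
  have "S \<in> face_lattice d n w \<longleftrightarrow> (\<exists>a\<in>coord_space d. \<exists>b. (\<forall>i\<in>{1..n}. coord_inner d a (w i) \<le> b) \<and>
      S = {i\<in>{1..n}. coord_inner d a (w i) = b})"
    unfolding face_lattice_def polytope_faces_def image_iff Bex_def mem_Collect_eq halfspace
    using labels by blast
  also have "\<dots> \<longleftrightarrow> S \<subseteq> {1..n} \<and>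
    (\<exists>a\<in>coord_space d. \<exists>b. (\<forall>i\<in>S. coord_inner d a (w i) = b) \<and>
       (\<forall>i\<in>{1..n} - S. coord_inner d a (w i) < b))"
  proof (intro iffI)
    assume "\<exists>a\<in>coord_space d. \<exists>b. (\<forall>i\<in>{1..n}. coord_inner d a (w i) \<le> b) \<and>
      S = {i\<in>{1..n}. coord_inner d a (w i) = b}"
    then obtain a b where "a \<in> coord_space d" "\<forall>i\<in>{1..n}. coord_inner d a (w i) \<le> b"
      "S = {i\<in>{1..n}. coord_inner d a (w i) = b}" by blast
    then show "S \<subseteq> {1..n} \<and> (\<exists>a\<in>coord_space d. \<exists>b. (\<forall>i\<in>S. coord_inner d a (w i) = b) \<and>
       (\<forall>i\<in>{1..n} - S. coord_inner d a (w i) < b))"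
      by (intro conjI bexI[of _ a] exI[of _ b]) (auto simp: less_le)
  next
    assume "S \<subseteq> {1..n} \<and> (\<exists>a\<in>coord_space d. \<exists>b. (\<forall>i\<in>S. coord_inner d a (w i) = b) \<and>
       (\<forall>i\<in>{1..n} - S. coord_inner d a (w i) < b))"
    then obtain a b where S: "S \<subseteq> {1..n}" "a \<in> coord_space d" "\<forall>i\<in>S. coord_inner d a (w i) = b"
      "\<forall>i\<in>{1..n} - S. coord_inner d a (w i) < b" by blast
    have "coord_inner d a (w i) \<le> b" if "i \<in> {1..n}" for i
      using S that by (cases "i \<in> S") (auto intro: less_imp_le)
    moreover have "S = {i\<in>{1..n}. coord_inner d a (w i) = b}"
      using S by (auto simp: less_le)
    ultimately show "\<exists>a\<in>coord_space d. \<exists>b. (\<forall>i\<in>{1..n}. coord_inner d a (w i) \<le> b) \<and>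
      S = {i\<in>{1..n}. coord_inner d a (w i) = b}"
      using S(2) by blast
  qed
  finally show ?thesis .
qed

lemma face_latticeI:
  assumes "labeled_polytope d n w" "S \<subseteq> {1..n}" "a \<in> coord_space d"
    and "\<And>i. i \<in> S \<Longrightarrow> coord_inner d a (w i) = b"
    and "\<And>i. i \<in> {1..n} - S \<Longrightarrow> coord_inner d a (w i) < b"
  shows "S \<in> face_lattice d n w"
  unfolding face_lattice_iff[OF assms(1)] using assms(2-)
  by (intro conjI bexI[of _ a] exI[of _ b] ballI)

text \<open>
  For points on the unit sphere the squared distance to \<open>c\<close> is an affine function, so empty spheres
  correspond to supporting hyperplanes. A hyperplane only determines the pair \<open>(c, s)\<close> after a choice
  of scale, and for a small scale \<open>t\<close> the resulting squared radius is positive.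
\<close>

lemma delaunay_subdivision_eq_face_lattice:
  assumes v: "inscribed_polytope d n v"
  shows "delaunay_subdivision d n v = face_lattice d n v"
proof -
  have lp: "labeled_polytope d n v" and pc: "point_configuration d n v"
    using v by (auto simp: inscribed_polytope_def labeled_polytope_def)
  have one: "coord_inner d (v i) (v i) = 1" if "i \<in> {1..n}" for i
  proof -
    have "(coord_dist d (v i) 0)\<^sup>2 = 1" using v that by (simp add: inscribed_polytope_def)
    then show ?thesis by (simp add: coord_dist_square) (simp add: coord_inner_def)
  qed
  have "S \<in> delaunay_subdivision d n v \<longleftrightarrow> S \<in> face_lattice d n v" for S
  proof
    assume "S \<in> delaunay_subdivision d n v"
    then obtain c s where S: "S \<subseteq> {1..n}" "c \<in> coord_space d"
      "\<forall>i\<in>S. coord_inner d (v i) (v i) - 2 * coord_inner d (v i) c = s"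
      "\<forall>i\<in>{1..n} - S. coord_inner d (v i) (v i) - 2 * coord_inner d (v i) c > s"
      unfolding delaunay_subdivision_power_iff[OF pc] by blast
    have "(\<forall>i\<in>S. coord_inner d c (v i) = (1 - s) / 2) \<and>
       (\<forall>i\<in>{1..n} - S. coord_inner d c (v i) < (1 - s) / 2)"
    proof (intro conjI ballI)
      fix i assume "i \<in> S"
      then show "coord_inner d c (v i) = (1 - s) / 2"
        using S(1) S(3)[rule_format, of i] one[of i] by (auto simp: coord_inner_commute[of d c "v i"])
    next
      fix i assume "i \<in> {1..n} - S"
      then show "coord_inner d c (v i) < (1 - s) / 2"
        using S(4)[rule_format, of i] one[of i] by (simp add: coord_inner_commute[of d c "v i"])
    qed
    then show "S \<in> face_lattice d n v"
      unfolding face_lattice_iff[OF lp] using S by blast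
  next
    assume "S \<in> face_lattice d n v"
    then obtain a b where S: "S \<subseteq> {1..n}" "a \<in> coord_space d"
      "\<forall>i\<in>S. coord_inner d a (v i) = b" "\<forall>i\<in>{1..n} - S. coord_inner d a (v i) < b"
      unfolding face_lattice_iff[OF lp] by blast
    define t where "t = 1 / (2 * (\<bar>b\<bar> + 1))"
    have t: "t > 0" "2 * t * b < 1"
      by (auto simp: t_def field_simps)
    define c where "c k = t * a k" for k
    have c: "c \<in> coord_space d" using S(2) by (auto simp: coord_space_iff c_def)
    have inner: "coord_inner d (v i) c = t * coord_inner d a (v i)" for i
      by (simp add: coord_inner_def c_def sum_distrib_left mult_ac)
    have "(1 - 2 * t * b) + coord_inner d c c > 0" using t coord_inner_nonneg[of d c] by linarith
    moreover have "\<forall>i\<in>S. coord_inner d (v i) (v i) - 2 * coord_inner d (v i) c = 1 - 2 * t * b"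
      using S one by (auto simp: inner)
    moreover have "\<forall>i\<in>{1..n} - S. coord_inner d (v i) (v i) - 2 * coord_inner d (v i) c > 1 - 2 * t * b"
      using S one t by (auto simp: inner)
    ultimately show "S \<in> delaunay_subdivision d n v"
      unfolding delaunay_subdivision_power_iff[OF pc] using S c by blast
  qed
  then show ?thesis by blast
qed

section \<open>Linear algebra over a subfield of the reals\<close>

definition real_subfield :: "real set \<Rightarrow> bool" where
  "real_subfield K \<longleftrightarrow> 0 \<in> K \<and> 1 \<in> K \<and> (\<forall>x\<in>K. \<forall>y\<in>K. x + y \<in> K \<and> x * y \<in> K) \<and>
     (\<forall>x\<in>K. - x \<in> K \<and> inverse x \<in> K)"

lemma real_subfield_closed:
  assumes "real_subfield K"
  shows "0 \<in> K" "1 \<in> K" "x \<in> K \<Longrightarrow> y \<in> K \<Longrightarrow> x + y \<in> K" "x \<in> K \<Longrightarrow> y \<in> K \<Longrightarrow> x * y \<in> K"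
    "x \<in> K \<Longrightarrow> - x \<in> K" "x \<in> K \<Longrightarrow> y \<in> K \<Longrightarrow> x - y \<in> K" "x \<in> K \<Longrightarrow> y \<in> K \<Longrightarrow> x / y \<in> K"
  using assms unfolding real_subfield_def
  by (blast, blast, blast, blast, blast, metis diff_conv_add_uminus, metis divide_inverse)

lemma real_subfield_sum:
  assumes "real_subfield K" "\<And>i. i \<in> I \<Longrightarrow> f i \<in> K"
  shows "sum f I \<in> K"
  using assms(2) by (induction I rule: infinite_finite_induct) (auto intro: real_subfield_closed[OF assms(1)])

lemma coord_inner_of_bool: "m0 < D \<Longrightarrow> coord_inner D (\<lambda>m. of_bool (m = m0)) z = z m0"
  by (simp add: coord_inner_def of_bool_def if_distrib[of "\<lambda>x. x * _"] cong: if_cong)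

lemma coord_inner_diff_left: "coord_inner D (\<lambda>m. f m - g m) z = coord_inner D f z - coord_inner D g z"
  by (simp add: coord_inner_def algebra_simps sum_subtractf)

lemma coord_inner_scale_left: "coord_inner D (\<lambda>m. r * f m) z = r * coord_inner D f z"
  by (simp add: coord_inner_def algebra_simps sum_distrib_left)

lemma coord_inner_sum_left: "coord_inner D (\<lambda>m. \<Sum>j\<in>I. f j m) z = (\<Sum>j\<in>I. coord_inner D (f j) z)"
  unfolding coord_inner_def sum_distrib_right by (rule sum.swap)

text \<open>
  Gaussian elimination over the field \<open>K\<close>. Given functionals dual to the vectors of \<open>V\<close>, subtract
  from the next vector its combination of the vectors of \<open>V\<close> that these functionals prescribe. If the
  residue \<open>r\<close> vanishes, a dependency is found. Otherwise a nonzero coordinate of \<open>r\<close>, corrected by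
  the old functionals, vanishes on \<open>V\<close> but not at the new vector. Only field operations occur, so all
  coefficients remain in \<open>K\<close>.
\<close>

lemma dependent_or_dual_functionals:
  assumes K: "real_subfield K" and "finite V" and z: "\<And>l m. l \<in> V \<Longrightarrow> m < D \<Longrightarrow> z l m \<in> K"
  shows "(\<exists>c. (\<forall>l\<in>V. c l \<in> K) \<and> (\<exists>l\<in>V. c l \<noteq> 0) \<and> (\<forall>m<D. (\<Sum>l\<in>V. c l * z l m) = 0)) \<or>
    (\<exists>\<psi>. \<forall>j\<in>V. (\<forall>m<D. \<psi> j m \<in> K) \<and> (\<forall>l\<in>V. coord_inner D (\<psi> j) (z l) = of_bool (l = j)))"
    (is "?dep V \<or> ?dual V")
  using \<open>finite V\<close> z
proof (induction V rule: finite_induct)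
  case empty
  then show ?case by simp
next
  case (insert l0 V)
  note closed = real_subfield_closed[OF K] real_subfield_sum[OF K]
  consider "?dep V" | "?dual V" using insert by blast
  then show ?case
  proof cases
    case 1
    then obtain c where c: "\<forall>l\<in>V. c l \<in> K" "\<exists>l\<in>V. c l \<noteq> 0" "\<forall>m<D. (\<Sum>l\<in>V. c l * z l m) = 0" by blast
    have "(\<Sum>l\<in>insert l0 V. (c(l0 := 0)) l * z l m) = (\<Sum>l\<in>V. c l * z l m)" for m
      using insert.hyps by (simp, intro sum.cong) auto
    moreover have "\<exists>l\<in>insert l0 V. (c(l0 := 0)) l \<noteq> 0" using c(2) insert.hyps by auto
    ultimately have "?dep (insert l0 V)"
      using c closed(1) by (intro exI[of _ "c(l0 := 0)"]) auto
    then show ?thesis ..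
  next
    case 2
    then obtain \<psi> where \<psi>K: "\<And>j m. j \<in> V \<Longrightarrow> m < D \<Longrightarrow> \<psi> j m \<in> K"
      and \<psi>: "\<And>j l. j \<in> V \<Longrightarrow> l \<in> V \<Longrightarrow> coord_inner D (\<psi> j) (z l) = of_bool (l = j)" by blast
    define p where "p j = coord_inner D (\<psi> j) (z l0)" for j
    have pK: "p j \<in> K" if "j \<in> V" for j
      unfolding p_def coord_inner_def using that \<psi>K insert.prems by (intro closed) auto
    define r where "r m = z l0 m - (\<Sum>j\<in>V. p j * z j m)" for m
    show ?thesis
    proof (cases "\<forall>m<D. r m = 0")
      case True
      define c where "c = (\<lambda>l. if l = l0 then 1 else - p l)"
      have "(\<Sum>l\<in>insert l0 V. c l * z l m) = r m" for m
      proof -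
        have "(\<Sum>l\<in>V. c l * z l m) = (\<Sum>l\<in>V. - (p l * z l m))"
          using insert.hyps by (intro sum.cong) (auto simp: c_def)
        then show ?thesis using insert.hyps by (simp add: r_def c_def sum_negf)
      qed
      then have "?dep (insert l0 V)" using True pK closed
        by (intro exI[of _ c]) (auto simp: c_def)
      then show ?thesis ..
    next
      case False
      then obtain m0 where m0: "m0 < D" "r m0 \<noteq> 0" by blast
      define \<psi>0 where "\<psi>0 m = (1 / r m0) * (of_bool (m = m0) - (\<Sum>j\<in>V. z j m0 * \<psi> j m))" for m
      have rK: "r m0 \<in> K" unfolding r_def using pK insert.prems m0 by (intro closed) auto
      have \<psi>0K: "\<psi>0 m \<in> K" if "m < D" for m
        unfolding \<psi>0_def using rK pK \<psi>K insert.prems m0 that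
        by (intro closed) (auto simp: of_bool_def closed)
      have \<psi>0: "coord_inner D \<psi>0 u = (1 / r m0) * (u m0 - (\<Sum>j\<in>V. z j m0 * coord_inner D (\<psi> j) u))" for u
        unfolding \<psi>0_def coord_inner_scale_left coord_inner_diff_left coord_inner_sum_left
        using m0 by (simp add: coord_inner_of_bool)
      have on: "coord_inner D \<psi>0 (z l) = 0" if "l \<in> V" for l
      proof -
        have "(\<Sum>j\<in>V. z j m0 * coord_inner D (\<psi> j) (z l)) = (\<Sum>j\<in>V. if j = l then z j m0 else 0)"
          using that \<psi> by (intro sum.cong) auto
        then show ?thesis unfolding \<psi>0 using that insert.hyps by simp
      qed
      have at: "coord_inner D \<psi>0 (z l0) = 1"
        unfolding \<psi>0 using m0 by (simp add: r_def p_def mult.commute)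
      define \<psi>' where "\<psi>' j = (if j = l0 then \<psi>0 else (\<lambda>m. \<psi> j m - p j * \<psi>0 m))" for j
      have "coord_inner D (\<psi>' j) (z l) = of_bool (l = j)" if "j \<in> insert l0 V" "l \<in> insert l0 V" for j l
        using that on at \<psi> insert.hyps
        by (auto simp: \<psi>'_def coord_inner_diff_left coord_inner_scale_left p_def)
      moreover have "\<psi>' j m \<in> K" if "j \<in> insert l0 V" "m < D" for j m
        using that \<psi>0K \<psi>K pK by (auto simp: \<psi>'_def intro!: closed)
      ultimately have "?dual (insert l0 V)" by blast
      then show ?thesis ..
    qed
  qed
qed

section \<open>Polytopes and Delaunay subdivisions in homogeneous coordinates\<close>

text \<open>
  What realizations of polytopes and of Delaunay subdivisions have in common after passing to
  homogeneous coordinates: the members of \<open>T\<close> are zero sets of functionals that are nonnegative on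
  all vectors, and inside a member whose vectors are linearly independent all subsets with at
  least two elements are members again. Linear independence is expressed by dual functionals. The bound on the cardinality ensures
  that a sphere through the subset has positive radius.
\<close>

definition vector_realization ::
    "real set \<Rightarrow> nat \<Rightarrow> nat \<Rightarrow> nat set set \<Rightarrow> (nat \<Rightarrow> nat \<Rightarrow> real) \<Rightarrow> bool" where
  "vector_realization K D n T z \<longleftrightarrow>
     (\<forall>l\<in>{1..n}. \<forall>m<D. z l m \<in> K) \<and>
     (\<forall>S\<in>T. S \<subseteq> {1..n} \<and>
        (\<exists>\<phi>. (\<forall>l\<in>S. coord_inner D \<phi> (z l) = 0) \<and> (\<forall>l\<in>{1..n} - S. coord_inner D \<phi> (z l) > 0))) \<and>
     (\<forall>V\<in>T. (\<exists>\<psi>. \<forall>j\<in>V. \<forall>l\<in>V. coord_inner D (\<psi> j) (z l) = of_bool (l = j)) \<longrightarrow>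
        (\<forall>U\<subseteq>V. 2 \<le> card U \<longrightarrow> U \<in> T))"

lemma vector_realizationI:
  assumes "\<And>l m. l \<in> {1..n} \<Longrightarrow> m < D \<Longrightarrow> z l m \<in> K"
    and "\<And>S. S \<in> T \<Longrightarrow> S \<subseteq> {1..n}"
    and "\<And>S. S \<in> T \<Longrightarrow>
      \<exists>\<phi>. (\<forall>l\<in>S. coord_inner D \<phi> (z l) = 0) \<and> (\<forall>l\<in>{1..n} - S. coord_inner D \<phi> (z l) > 0)"
    and "\<And>V U \<psi>. V \<in> T \<Longrightarrow> \<forall>j\<in>V. \<forall>l\<in>V. coord_inner D (\<psi> j) (z l) = of_bool (l = j) \<Longrightarrow>
      U \<subseteq> V \<Longrightarrow> 2 \<le> card U \<Longrightarrow> U \<in> T"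
  shows "vector_realization K D n T z"
  unfolding vector_realization_def
  by (intro conjI ballI allI impI; (elim exE)?) (rule assms; assumption)+

lemma small_perturbation_positive:
  fixes g h :: "'i \<Rightarrow> real"
  assumes "finite I" "\<And>i. i \<in> I \<Longrightarrow> g i > 0"
  shows "\<exists>\<epsilon>>0. \<forall>i\<in>I. g i + \<epsilon> * h i > 0"
proof -
  have "\<forall>\<^sub>F \<epsilon> in at_right 0. g i + \<epsilon> * h i > 0" if "i \<in> I" for i
  proof -
    have "((\<lambda>\<epsilon>. g i + \<epsilon> * h i) \<longlongrightarrow> g i + 0 * h i) (at_right 0)"
      by (intro tendsto_intros)
    then show ?thesis using assms(2)[OF that] by (intro order_tendstoD(1)) auto
  qed
  then have "\<forall>\<^sub>F \<epsilon> in at_right 0. \<forall>i\<in>I. g i + \<epsilon> * h i > 0"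
    using assms(1) by (simp add: eventually_ball_finite)
  moreover have "\<forall>\<^sub>F \<epsilon> in at_right 0. \<epsilon> > (0::real)" by (rule eventually_at_right_less)
  ultimately have "\<forall>\<^sub>F \<epsilon> in at_right 0. \<epsilon> > 0 \<and> (\<forall>i\<in>I. g i + \<epsilon> * h i > 0)"
    by eventually_elim auto
  then show ?thesis
    by (rule eventually_happens'[rotated]) simp
qed

text \<open>
  If the homogenized vertices of a face \<open>V\<close> are independent, then some functional is 0 on \<open>U\<close> and 1 on
  \<open>V - U\<close>. Adding a small multiple of it to a functional that supports \<open>V\<close> isolates \<open>U\<close>.
\<close>

lemma polytope_vector_realization:
  assumes K: "real_subfield K" and w: "labeled_polytope d n w"
    and wK: "\<And>i k. i \<in> {1..n} \<Longrightarrow> k < d \<Longrightarrow> w i k \<in> K"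
  shows "vector_realization K (Suc d) n (face_lattice d n w) (\<lambda>i m. if m < d then w i m else 1)"
    (is "vector_realization K _ n ?T ?z")
proof -
  have inner: "coord_inner (Suc d) \<phi> (?z i) = coord_inner d \<phi> (w i) + \<phi> d" for \<phi> i
    by (simp add: coord_inner_def)
  have "\<exists>\<phi>. (\<forall>l\<in>S. coord_inner (Suc d) \<phi> (?z l) = 0) \<and> (\<forall>l\<in>{1..n} - S. coord_inner (Suc d) \<phi> (?z l) > 0)"
    if "S \<in> ?T" for S
  proof -
    from that obtain a b where ab: "\<forall>i\<in>S. coord_inner d a (w i) = b" "\<forall>i\<in>{1..n} - S. coord_inner d a (w i) < b"
      unfolding face_lattice_iff[OF w] by blast
    have "coord_inner (Suc d) (\<lambda>m. if m < d then - a m else b) (?z i) = b - coord_inner d a (w i)" for i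
      unfolding inner by (simp add: coord_inner_def sum_negf)
    then show ?thesis
      using ab by (intro exI[of _ "\<lambda>m. if m < d then - a m else b"]) simp
  qed
  moreover have "U \<in> ?T"
    if V: "V \<in> ?T" and \<psi>: "\<forall>j\<in>V. \<forall>l\<in>V. coord_inner (Suc d) (\<psi> j) (?z l) = of_bool (l = j)" and U: "U \<subseteq> V"
    for U V and \<psi> :: "nat \<Rightarrow> nat \<Rightarrow> real"
  proof -
    from V obtain a b where Vn: "V \<subseteq> {1..n}" and a: "a \<in> coord_space d"
      "\<forall>i\<in>V. coord_inner d a (w i) = b" "\<forall>i\<in>{1..n} - V. coord_inner d a (w i) < b"
      unfolding face_lattice_iff[OF w] by blast
    have "finite V" using Vn finite_subset by blast
    define \<theta> where "\<theta> m = (\<Sum>j\<in>V - U. \<psi> j m)" for m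
    have \<theta>: "coord_inner (Suc d) \<theta> (?z l) = of_bool (l \<in> V - U)" if "l \<in> V" for l
    proof -
      have "coord_inner (Suc d) \<theta> (?z l) = (\<Sum>j\<in>V - U. coord_inner (Suc d) (\<psi> j) (?z l))"
        unfolding \<theta>_def by (rule coord_inner_sum_left)
      also have "\<dots> = (\<Sum>j\<in>V - U. if j = l then 1 else 0)" using \<psi> that by (intro sum.cong) auto
      finally show ?thesis using \<open>finite V\<close> by simp
    qed
    have fin: "finite ({1..n} - V)" by simp
    have pos: "b - coord_inner d a (w i) > 0" if "i \<in> {1..n} - V" for i using a(3) that by auto
    obtain \<epsilon> where \<epsilon>: "\<epsilon> > 0" "\<forall>i\<in>{1..n} - V.
        (b - coord_inner d a (w i)) + \<epsilon> * coord_inner (Suc d) \<theta> (?z i) > 0"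
      using small_perturbation_positive[OF fin, of "\<lambda>i. b - coord_inner d a (w i)"
          "\<lambda>i. coord_inner (Suc d) \<theta> (?z i)", OF pos] by blast
    define a' where "a' m = (if m < d then a m - \<epsilon> * \<theta> m else 0)" for m
    define b' where "b' = b + \<epsilon> * \<theta> d"
    have slack: "b' - coord_inner d a' (w i) = (b - coord_inner d a (w i)) + \<epsilon> * coord_inner (Suc d) \<theta> (?z i)" for i
      unfolding inner by (simp add: a'_def b'_def coord_inner_def algebra_simps sum_subtractf sum_distrib_left)
    have "coord_inner d a' (w i) = b'" if "i \<in> U" for i
    proof -
      have "i \<in> V" using that U by blast
      have "coord_inner (Suc d) \<theta> (?z i) = 0" unfolding \<theta>[OF \<open>i \<in> V\<close>] using that by simp
      moreover have "coord_inner d a (w i) = b" using a(2) \<open>i \<in> V\<close> by blast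
      ultimately show ?thesis using slack[of i] by simp
    qed
    moreover have "coord_inner d a' (w i) < b'" if "i \<in> {1..n} - U" for i
    proof (cases "i \<in> V")
      case True
      have "coord_inner (Suc d) \<theta> (?z i) = 1" unfolding \<theta>[OF True] using that True by simp
      moreover have "coord_inner d a (w i) = b" using a(2) True by blast
      ultimately show ?thesis using slack[of i] \<epsilon>(1) by simp
    next
      case False
      then have "i \<in> {1..n} - V" using that by blast
      from \<epsilon>(2)[THEN bspec, OF this] have "b' - coord_inner d a' (w i) > 0" unfolding slack .
      then show ?thesis by simp
    qed
    moreover have "a' \<in> coord_space d" by (simp add: coord_space_iff a'_def)
    ultimately show "U \<in> ?T" by (intro face_latticeI[OF w subset_trans[OF U Vn], of a' b'])
  qed
  moreover have "S \<subseteq> {1..n}" if "S \<in> ?T" for S using that by (simp add: face_lattice_iff[OF w])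
  moreover have "?z l m \<in> K" if "l \<in> {1..n}" for l m
    using that wK real_subfield_closed(2)[OF K] by simp
  ultimately show ?thesis by (intro vector_realizationI)
qed

text \<open>
  The same perturbation on the paraboloid. The tilted hyperplane is the lift of a sphere again,
  because the coefficient of the squared norm stays positive. This sphere does not degenerate to a
  point, because it passes through at least two points.
\<close>

lemma delaunay_vector_realization:
  assumes K: "real_subfield K" and A: "point_configuration d n A"
    and AK: "\<And>i k. i \<in> {1..n} \<Longrightarrow> k < d \<Longrightarrow> A i k \<in> K"
  shows "vector_realization K (Suc (Suc d)) n (delaunay_subdivision d n A)
    (\<lambda>i m. if m < d then A i m else if m = d then coord_inner d (A i) (A i) else 1)"
    (is "vector_realization K ?D n ?T ?z")
proof -
  have inner: "coord_inner ?D \<phi> (?z i) = coord_inner d \<phi> (A i) + \<phi> d * coord_inner d (A i) (A i) + \<phi> (Suc d)" for \<phi> i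
    by (simp add: coord_inner_def)
  have "\<exists>\<phi>. (\<forall>l\<in>S. coord_inner ?D \<phi> (?z l) = 0) \<and> (\<forall>l\<in>{1..n} - S. coord_inner ?D \<phi> (?z l) > 0)"
    if "S \<in> ?T" for S
  proof -
    from that obtain c s where cs: "\<forall>i\<in>S. coord_inner d (A i) (A i) - 2 * coord_inner d (A i) c = s"
       "\<forall>i\<in>{1..n} - S. coord_inner d (A i) (A i) - 2 * coord_inner d (A i) c > s"
      unfolding delaunay_subdivision_power_iff[OF A] by blast
    let ?\<phi> = "\<lambda>m. if m < d then - 2 * c m else if m = d then 1 else - s"
    have "coord_inner ?D ?\<phi> (?z i) = coord_inner d (A i) (A i) - 2 * coord_inner d (A i) c - s" for i
      unfolding inner by (simp add: coord_inner_def sum_distrib_left sum_negf mult_ac)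
    then show ?thesis
      using cs by (intro exI[of _ ?\<phi>]) simp
  qed
  moreover have "U \<in> ?T"
    if V: "V \<in> ?T" and \<psi>: "\<forall>j\<in>V. \<forall>l\<in>V. coord_inner ?D (\<psi> j) (?z l) = of_bool (l = j)"
      and U: "U \<subseteq> V" "2 \<le> card U"
    for U V and \<psi> :: "nat \<Rightarrow> nat \<Rightarrow> real"
  proof -
    from V obtain c s where Vn: "V \<subseteq> {1..n}" and c: "c \<in> coord_space d"
      "\<forall>i\<in>V. coord_inner d (A i) (A i) - 2 * coord_inner d (A i) c = s"
      "\<forall>i\<in>{1..n} - V. coord_inner d (A i) (A i) - 2 * coord_inner d (A i) c > s"
      unfolding delaunay_subdivision_power_iff[OF A] by blast
    have "finite V" using Vn finite_subset by blast
    define \<theta> where "\<theta> m = (\<Sum>j\<in>V - U. \<psi> j m)" for m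
    have \<theta>: "coord_inner ?D \<theta> (?z l) = of_bool (l \<in> V - U)" if "l \<in> V" for l
    proof -
      have "coord_inner ?D \<theta> (?z l) = (\<Sum>j\<in>V - U. coord_inner ?D (\<psi> j) (?z l))"
        unfolding \<theta>_def by (rule coord_inner_sum_left)
      also have "\<dots> = (\<Sum>j\<in>V - U. if j = l then 1 else 0)" using \<psi> that by (intro sum.cong) auto
      finally show ?thesis using \<open>finite V\<close> by simp
    qed
    let ?p = "\<lambda>i. coord_inner d (A i) (A i) - 2 * coord_inner d (A i) c - s"
    have fin: "finite (insert 0 ({1..n} - V))" by simp
    have pos: "(if i = 0 then 1 else ?p i) > 0" if "i \<in> insert 0 ({1..n} - V)" for i
      using c(3) that by auto
    \<comment> \<open>The index \<open>0\<close> is not a label. It stands for the coefficient of the squared norm, which must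
      stay positive for the perturbed functional to describe a sphere.\<close>
    obtain \<epsilon> where \<epsilon>: "\<epsilon> > 0" "\<forall>i\<in>insert 0 ({1..n} - V).
        (if i = 0 then 1 else ?p i) + \<epsilon> * (if i = 0 then \<theta> d else coord_inner ?D \<theta> (?z i)) > 0"
      using small_perturbation_positive[OF fin, of "\<lambda>i. if i = 0 then 1 else ?p i"
          "\<lambda>i. if i = 0 then \<theta> d else coord_inner ?D \<theta> (?z i)", OF pos] by blast
    define \<tau> where "\<tau> = 1 + \<epsilon> * \<theta> d"
    have \<tau>: "\<tau> > 0" using \<epsilon>(2)[THEN bspec, of 0] by (simp add: \<tau>_def)
    define c' where "c' m = (if m < d then (2 * c m - \<epsilon> * \<theta> m) / (2 * \<tau>) else 0)" for m
    define s' where "s' = (s - \<epsilon> * \<theta> (Suc d)) / \<tau>"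
    have c': "c' \<in> coord_space d" by (simp add: coord_space_iff c'_def)
    have "\<tau> * (coord_inner d (A i) (A i) - 2 * coord_inner d (A i) c' - s') = ?p i + \<epsilon> * coord_inner ?D \<theta> (?z i)" for i
    proof -
      have "2 * \<tau> * coord_inner d (A i) c' = 2 * coord_inner d (A i) c - \<epsilon> * coord_inner d \<theta> (A i)"
        using \<tau> unfolding coord_inner_def sum_distrib_left sum_subtractf[symmetric]
        by (intro sum.cong) (auto simp: c'_def field_simps)
      moreover have "\<tau> * s' = s - \<epsilon> * \<theta> (Suc d)" using \<tau> by (simp add: s'_def)
      ultimately show ?thesis unfolding inner by (simp add: \<tau>_def algebra_simps)
    qed
    then have power: "coord_inner d (A i) (A i) - 2 * coord_inner d (A i) c' - s' =
        (?p i + \<epsilon> * coord_inner ?D \<theta> (?z i)) / \<tau>" for i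
      using \<tau> by (metis less_irrefl nonzero_mult_div_cancel_left)
    have on: "coord_inner d (A i) (A i) - 2 * coord_inner d (A i) c' = s'" if "i \<in> U" for i
    proof -
      have "i \<in> V" using that U by blast
      have "coord_inner ?D \<theta> (?z i) = 0" unfolding \<theta>[OF \<open>i \<in> V\<close>] using that by simp
      moreover have "?p i = 0" using c(2) \<open>i \<in> V\<close> by simp
      ultimately have "?p i + \<epsilon> * coord_inner ?D \<theta> (?z i) = 0" by simp
      then show ?thesis using power[of i] by simp
    qed
    have off: "coord_inner d (A i) (A i) - 2 * coord_inner d (A i) c' > s'" if "i \<in> {1..n} - U" for i
    proof -
      have "?p i + \<epsilon> * coord_inner ?D \<theta> (?z i) > 0"
      proof (cases "i \<in> V")
        case True
        have "coord_inner ?D \<theta> (?z i) = 1" unfolding \<theta>[OF True] using that True by simp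
        moreover have "?p i = 0" using c(2) True by simp
        ultimately show ?thesis using \<epsilon>(1) by simp
      next
        case False
        then have "i \<in> insert 0 ({1..n} - V)" "i \<noteq> 0" using that by auto
        then show ?thesis using \<epsilon>(2)[THEN bspec, of i] by (simp only: if_False)
      qed
      then have "(?p i + \<epsilon> * coord_inner ?D \<theta> (?z i)) / \<tau> > 0" using \<tau> by simp
      then show ?thesis using power[of i] by linarith
    qed
    have "s' + coord_inner d c' c' > 0"
    proof -
      have "finite U" using U(1) \<open>finite V\<close> by (rule finite_subset)
      moreover have "\<not> card U \<le> Suc 0" using U(2) by linarith
      ultimately obtain i j where ij: "i \<in> U" "j \<in> U" "i \<noteq> j"
        using card_le_Suc0_iff_eq[of U] by blast
      have "U \<subseteq> {1..n}" using U(1) Vn by (rule subset_trans)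
      have "A i \<noteq> A j"
        using A ij \<open>U \<subseteq> {1..n}\<close> unfolding point_configuration_def by (meson inj_onD subsetD)
      then obtain l where l: "l \<in> U" "A l \<noteq> c'" using ij by metis
      have "A l \<in> coord_space d"
        using A l(1) \<open>U \<subseteq> {1..n}\<close> unfolding point_configuration_def by blast
      then have "coord_dist d (A l) c' > 0"
        using coord_dist_eq_0_iff[OF _ c', of "A l"] l(2) coord_dist_nonneg[of d "A l" c'] by simp
      then have "(coord_dist d (A l) c')\<^sup>2 > 0" by simp
      then show ?thesis using on[OF l(1)] by (simp add: coord_dist_square)
    qed
    then show "U \<in> ?T"
      by (rule delaunay_subdivision_powerI[OF A subset_trans[OF U(1) Vn] c' _ on off])
  qed
  moreover have "S \<subseteq> {1..n}" if "S \<in> ?T" for S using that by (simp add: delaunay_subdivision_power_iff[OF A])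
  moreover have "?z l m \<in> K" if "l \<in> {1..n}" for l m
    using that AK real_subfield_closed[OF K]
    by (auto simp: coord_inner_def intro!: real_subfield_sum[OF K])
  ultimately show ?thesis by (intro vector_realizationI)
qed

lemma unit_points_inscribed_polytope:
  assumes v: "point_configuration d n v" and one: "\<And>i. i \<in> {1..n} \<Longrightarrow> coord_inner d (v i) (v i) = 1"
  shows "inscribed_polytope d n v"
proof -
  have "v i extreme_point_of (convex hull (v ` {1..n}))" if i: "i \<in> {1..n}" for i
  proof (rule strict_maximum_imp_extreme_point[OF linear_coord_inner[of d "v i"]])
    fix u assume "u \<in> v ` {1..n}" "u \<noteq> v i"
    then obtain j where j: "j \<in> {1..n}" "u = v j" "v i \<noteq> v j" by auto
    have "v i \<in> coord_space d" "v j \<in> coord_space d" using v i j by (auto simp: point_configuration_def)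
    then have "coord_dist d (v i) (v j) > 0"
      using coord_dist_eq_0_iff[of "v i" d "v j"] j(3) coord_dist_nonneg[of d "v i" "v j"] by simp
    then have "(coord_dist d (v i) (v j))\<^sup>2 > 0" by simp
    then show "coord_inner d (v i) u < coord_inner d (v i) (v i)"
      using one[OF i] one[OF j(1)] j by (simp add: coord_dist_square)
  qed (use i in auto)
  moreover have "coord_dist d (v i) 0 = 1" if "i \<in> {1..n}" for i
  proof -
    have "(coord_dist d (v i) 0)\<^sup>2 = 1"
      using one[OF that] by (simp add: coord_dist_square) (simp add: coord_inner_def)
    then show ?thesis using coord_dist_nonneg[of d "v i" 0] by (simp add: power2_eq_1_iff)
  qed
  ultimately show ?thesis using v by (simp add: inscribed_polytope_def labeled_polytope_def)
qed

section \<open>Lawrence polytopes\<close>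

text \<open>
  The faces of the Lawrence polytope of the vectors \<open>a 0, \<dots>, a (N - 1)\<close>. The labels \<open>Suc i\<close> and
  \<open>Suc (N + i)\<close> belong to the two points over \<open>a i\<close>, at which a supporting functional takes the
  values \<open>h i \<mp> c \<bullet> a i\<close>. Since \<open>h\<close> is arbitrary, the family records for every \<open>c\<close> the signs of
  all the numbers \<open>c \<bullet> a i\<close>, which is the oriented matroid of the vectors.
\<close>

definition lawrence_faces :: "nat \<Rightarrow> nat \<Rightarrow> (nat \<Rightarrow> nat \<Rightarrow> real) \<Rightarrow> nat set set" where
  "lawrence_faces k N a = {S. S \<subseteq> {1..2 * N} \<and> (\<exists>c h. \<forall>i<N.
     \<bar>coord_inner k c (a i)\<bar> \<le> h i \<and>
     (Suc i \<in> S \<longleftrightarrow> h i = coord_inner k c (a i)) \<and>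
     (Suc (N + i) \<in> S \<longleftrightarrow> h i = - coord_inner k c (a i)))}"

lemma lawrence_facesI:
  assumes "S \<subseteq> {1..2 * N}"
    and "\<And>i. i < N \<Longrightarrow> \<bar>coord_inner k c (a i)\<bar> \<le> h i"
    and "\<And>i. i < N \<Longrightarrow> Suc i \<in> S \<longleftrightarrow> h i = coord_inner k c (a i)"
    and "\<And>i. i < N \<Longrightarrow> Suc (N + i) \<in> S \<longleftrightarrow> h i = - coord_inner k c (a i)"
  shows "S \<in> lawrence_faces k N a"
  using assms unfolding lawrence_faces_def mem_Collect_eq
  by (intro conjI exI[of _ c] exI[of _ h] allI impI)

definition label_pairs :: "nat \<Rightarrow> nat set \<Rightarrow> nat set" where
  "label_pairs N C = Suc ` C \<union> (\<lambda>i. Suc (N + i)) ` C"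

lemma Suc_mem_label_pairs:
  assumes "C \<subseteq> {..<N}" "i < N"
  shows "Suc i \<in> label_pairs N C \<longleftrightarrow> i \<in> C" "Suc (N + i) \<in> label_pairs N C \<longleftrightarrow> i \<in> C"
  using assms by (auto simp: label_pairs_def)

lemma sum_label_pairs:
  assumes "C \<subseteq> {..<N}"
  shows "(\<Sum>l\<in>label_pairs N C. f l) = (\<Sum>i\<in>C. f (Suc i) + f (Suc (N + i)))"
proof -
  have "finite C" using assms finite_subset by blast
  then have "(\<Sum>l\<in>label_pairs N C. f l) = sum f (Suc ` C) + sum f ((\<lambda>i. Suc (N + i)) ` C)"
    unfolding label_pairs_def using assms by (intro sum.union_disjoint) auto
  then show ?thesis by (simp add: sum.reindex sum.distrib inj_on_def)
qed

lemma label_pairs_in_lawrence_faces: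
  assumes "C \<subseteq> {..<N}"
  shows "label_pairs N C \<in> lawrence_faces k N a"
proof -
  have sub: "label_pairs N C \<subseteq> {1..2 * N}" using assms by (auto simp: label_pairs_def)
  have 0: "coord_inner k (\<lambda>_. 0) (a i) = 0" for i by (simp add: coord_inner_def)
  show ?thesis
    using Suc_mem_label_pairs[OF assms]
    by (intro lawrence_facesI[where c = "\<lambda>_. 0" and h = "\<lambda>i. of_bool (i \<notin> C)"] sub) (auto simp: 0)
qed

lemma covector_face_in_lawrence_faces:
  assumes B: "B \<subseteq> {..<N}" and i: "i < N" "i \<notin> B"
    and c: "coord_inner k c (a i) > 0" "\<And>j. j \<in> B \<Longrightarrow> coord_inner k c (a j) = 0"
  shows "insert (Suc i) (label_pairs N B) \<in> lawrence_faces k N a"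
proof -
  let ?S = "insert (Suc i) (label_pairs N B)"
  \<comment> \<open>Elsewhere \<open>h\<close> exceeds the covector, so that the face avoids both points of the pair.\<close>
  define h where "h j = (if j \<in> B then 0 else if j = i then coord_inner k c (a i)
      else \<bar>coord_inner k c (a j)\<bar> + 1)" for j
  have sub: "?S \<subseteq> {1..2 * N}" using B i by (auto simp: label_pairs_def)
  have h: "\<bar>coord_inner k c (a j)\<bar> \<le> h j" for j
    using c by (auto simp: h_def)
  have "Suc j \<in> ?S \<longleftrightarrow> h j = coord_inner k c (a j)" if "j < N" for j
    using Suc_mem_label_pairs[OF B that] c i by (auto simp: h_def)
  moreover have "Suc (N + j) \<in> ?S \<longleftrightarrow> h j = - coord_inner k c (a j)" if "j < N" for j
    using Suc_mem_label_pairs[OF B that] c i by (auto simp: h_def)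
  ultimately show ?thesis
    by (rule lawrence_facesI[OF sub h])
qed

text \<open>
  On a face that contains one point of each pair, but not its partner, the covector \<open>c\<close> is nonzero at
  \<open>a i\<close> with the sign of \<open>\<mu> i\<close>. Then the sum of the numbers \<open>\<mu> i * (c \<bullet> a i)\<close> is positive, although
  the linear relation makes it vanish.
\<close>

lemma positive_part_not_in_lawrence_faces:
  assumes C: "C \<subseteq> {..<N}" "C \<noteq> {}" and \<mu>: "\<And>i. i \<in> C \<Longrightarrow> \<mu> i \<noteq> 0"
    and rel: "\<And>m. m < k \<Longrightarrow> (\<Sum>i\<in>C. \<mu> i * a i m) = 0"
  shows "(\<lambda>i. if \<mu> i > 0 then Suc i else Suc (N + i)) ` C \<notin> lawrence_faces k N a"
proof
  let ?U = "(\<lambda>i. if \<mu> i > 0 then Suc i else Suc (N + i)) ` C"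
  assume "?U \<in> lawrence_faces k N a"
  then obtain c h where le: "\<And>i. i < N \<Longrightarrow> \<bar>coord_inner k c (a i)\<bar> \<le> h i"
    and x: "\<And>i. i < N \<Longrightarrow> Suc i \<in> ?U \<longleftrightarrow> h i = coord_inner k c (a i)"
    and y: "\<And>i. i < N \<Longrightarrow> Suc (N + i) \<in> ?U \<longleftrightarrow> h i = - coord_inner k c (a i)"
    unfolding lawrence_faces_def by blast
  have "\<mu> i * coord_inner k c (a i) > 0" if i: "i \<in> C" for i
  proof -
    have "i < N" using C i by auto
    have "Suc i \<in> ?U \<longleftrightarrow> \<mu> i > 0"
      using i C by (auto simp: image_iff)
    moreover have "Suc (N + i) \<in> ?U \<longleftrightarrow> \<mu> i < 0"
      using i C \<mu>[OF i] by (force simp: image_iff split: if_splits)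
    ultimately show ?thesis
      using le[OF \<open>i < N\<close>] x[OF \<open>i < N\<close>] y[OF \<open>i < N\<close>] \<mu>[OF i]
      by (cases "\<mu> i > 0") (auto simp: zero_less_mult_iff)
  qed
  then have "(\<Sum>i\<in>C. \<mu> i * coord_inner k c (a i)) > 0"
    using C finite_subset by (intro sum_pos) auto
  moreover have "(\<Sum>i\<in>C. \<mu> i * coord_inner k c (a i)) = (\<Sum>m<k. c m * (\<Sum>i\<in>C. \<mu> i * a i m))"
    unfolding coord_inner_def sum_distrib_left by (subst sum.swap) (simp add: mult_ac)
  ultimately show False using rel by simp
qed

text \<open>
  A realization of a Lawrence face family contains a realization of the underlying vectors. For each
  \<open>i\<close> all pairs but the \<open>i\<close>-th form a face, so some functional \<open>\<phi> i\<close> vanishes on all these pairs and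
  is positive on the \<open>i\<close>-th one. Applied to a linear dependency among the \<open>2 * N\<close> vectors \<open>z\<close>, it
  yields a fixed ratio of the two coefficients of the \<open>i\<close>-th pair. Every dependency is therefore one
  among the vectors \<open>t i = z (Suc i) - \<rho> i * z (Suc (N + i))\<close>.

  Independence passes to the \<open>t i\<close> by means of covectors. Conversely, a relation among the \<open>a i\<close>
  excludes a subset of a face from being a face, hence the vectors of that face are dependent, with
  coefficients in the field \<open>K\<close> of their coordinates. The vectors \<open>t i\<close> themselves may have
  coordinates outside of \<open>K\<close>, as the numbers \<open>\<rho> i\<close> are real.
\<close>

lemma lawrence_realization_vectors:
  assumes K: "real_subfield K"
    and z: "vector_realization K D (2 * N) (lawrence_faces k N a) z"
  obtains t :: "nat \<Rightarrow> nat \<Rightarrow> real" where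
    "\<And>B \<gamma>. B \<subseteq> {..<N} \<Longrightarrow>
      (\<And>i. i \<in> B \<Longrightarrow> \<exists>c. coord_inner k c (a i) > 0 \<and> (\<forall>j\<in>B - {i}. coord_inner k c (a j) = 0)) \<Longrightarrow>
      (\<Sum>i\<in>B. \<gamma> i *\<^sub>R t i) = 0 \<Longrightarrow> \<forall>i\<in>B. \<gamma> i = 0"
    "\<And>C \<mu>. C \<subseteq> {..<N} \<Longrightarrow> 2 \<le> card C \<Longrightarrow> (\<And>i. i \<in> C \<Longrightarrow> \<mu> i \<noteq> 0) \<Longrightarrow>
      (\<And>m. m < k \<Longrightarrow> (\<Sum>i\<in>C. \<mu> i * a i m) = 0) \<Longrightarrow>
      \<exists>\<alpha>. (\<forall>i\<in>C. \<alpha> i \<in> K) \<and> (\<exists>i\<in>C. \<alpha> i \<noteq> 0) \<and> (\<Sum>i\<in>C. \<alpha> i *\<^sub>R t i) = 0"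
proof -
  have zK: "\<And>l m. l \<in> {1..2 * N} \<Longrightarrow> m < D \<Longrightarrow> z l m \<in> K"
    and face: "\<And>S. S \<in> lawrence_faces k N a \<Longrightarrow> \<exists>\<phi>. (\<forall>l\<in>S. coord_inner D \<phi> (z l) = 0) \<and>
        (\<forall>l\<in>{1..2 * N} - S. coord_inner D \<phi> (z l) > 0)"
    and subface: "\<And>V U \<psi>. V \<in> lawrence_faces k N a \<Longrightarrow>
        (\<forall>j\<in>V. \<forall>l\<in>V. coord_inner D (\<psi> j) (z l) = of_bool (l = j)) \<Longrightarrow>
        U \<subseteq> V \<Longrightarrow> 2 \<le> card U \<Longrightarrow> U \<in> lawrence_faces k N a"
    using z unfolding vector_realization_def by (blast, blast, blast)
  have "\<exists>\<phi>. coord_inner D \<phi> (z (Suc i)) > 0 \<and> coord_inner D \<phi> (z (Suc (N + i))) > 0 \<and>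
      (\<forall>j<N. j \<noteq> i \<longrightarrow> coord_inner D \<phi> (z (Suc j)) = 0 \<and> coord_inner D \<phi> (z (Suc (N + j))) = 0)"
    if "i < N" for i
  proof -
    have sub: "{..<N} - {i} \<subseteq> {..<N}" by auto
    obtain \<phi> where \<phi>: "\<forall>l\<in>label_pairs N ({..<N} - {i}). coord_inner D \<phi> (z l) = 0"
      "\<forall>l\<in>{1..2 * N} - label_pairs N ({..<N} - {i}). coord_inner D \<phi> (z l) > 0"
      using face[OF label_pairs_in_lawrence_faces[OF sub]] by blast
    show ?thesis
      using \<phi> that Suc_mem_label_pairs[OF sub] by (intro exI[of _ \<phi>]) auto
  qed
  then obtain \<phi> where \<phi>: "\<And>i. i < N \<Longrightarrow> coord_inner D (\<phi> i) (z (Suc i)) > 0"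
      "\<And>i. i < N \<Longrightarrow> coord_inner D (\<phi> i) (z (Suc (N + i))) > 0"
      "\<And>i j. i < N \<Longrightarrow> j < N \<Longrightarrow> j \<noteq> i \<Longrightarrow>
        coord_inner D (\<phi> i) (z (Suc j)) = 0 \<and> coord_inner D (\<phi> i) (z (Suc (N + j))) = 0"
    by metis
  define \<rho> where "\<rho> i = coord_inner D (\<phi> i) (z (Suc i)) / coord_inner D (\<phi> i) (z (Suc (N + i)))" for i
  have \<rho>: "\<rho> i > 0" if "i < N" for i using \<phi> that by (simp add: \<rho>_def)
  define t where "t i m = (if m < D then z (Suc i) m - \<rho> i * z (Suc (N + i)) m else 0)" for i m
  have sum_t: "(\<Sum>i\<in>B. \<gamma> i *\<^sub>R t i) m = (\<Sum>i\<in>B. \<gamma> i * t i m)" for B :: "nat set" and \<gamma> m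
    by (induction B rule: infinite_finite_induct) (auto simp: scaleR_fun_def)
  show thesis
  proof (rule that[of t])
    fix B \<gamma> assume B: "B \<subseteq> {..<N}"
      and ind: "\<And>i. i \<in> B \<Longrightarrow> \<exists>c. coord_inner k c (a i) > 0 \<and> (\<forall>j\<in>B - {i}. coord_inner k c (a j) = 0)"
      and zero: "(\<Sum>i\<in>B. \<gamma> i *\<^sub>R t i) = 0"
    show "\<forall>i\<in>B. \<gamma> i = 0"
    proof
      fix i assume i: "i \<in> B"
      then have "i < N" using B by auto
      obtain c where "coord_inner k c (a i) > 0" "\<forall>j\<in>B - {i}. coord_inner k c (a j) = 0"
        using ind[OF i] by blast
      then have "insert (Suc i) (label_pairs N (B - {i})) \<in> lawrence_faces k N a" (is "?S \<in> _")
        using B i by (intro covector_face_in_lawrence_faces) auto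
      then obtain \<theta> where \<theta>: "\<forall>l\<in>?S. coord_inner D \<theta> (z l) = 0"
        "\<forall>l\<in>{1..2 * N} - ?S. coord_inner D \<theta> (z l) > 0" using face by blast
      have inner_t: "coord_inner D \<theta> (t j) = coord_inner D \<theta> (z (Suc j)) - \<rho> j * coord_inner D \<theta> (z (Suc (N + j)))" for j
        by (simp add: coord_inner_def t_def sum_subtractf sum_distrib_left algebra_simps)
      have "Suc (N + i) \<notin> ?S" using \<open>i < N\<close> B by (auto simp: label_pairs_def)
      then have "coord_inner D \<theta> (t i) < 0"
        using \<theta> \<open>i < N\<close> \<rho>[OF \<open>i < N\<close>] by (simp add: inner_t)
      moreover have "coord_inner D \<theta> (t j) = 0" if "j \<in> B - {i}" for j
        using \<theta>(1) that by (simp add: inner_t label_pairs_def)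
      moreover have "(\<Sum>j\<in>B. \<gamma> j * coord_inner D \<theta> (t j)) = 0"
      proof -
        have "(\<Sum>j\<in>B. \<gamma> j * coord_inner D \<theta> (t j)) = coord_inner D \<theta> (\<lambda>m. \<Sum>j\<in>B. \<gamma> j * t j m)"
          unfolding coord_inner_def sum_distrib_left by (subst sum.swap) (simp add: mult_ac)
        also have "\<dots> = 0" using zero sum_t[of \<gamma> B] by (simp add: coord_inner_def)
        finally show ?thesis .
      qed
      ultimately have "\<gamma> i * coord_inner D \<theta> (t i) = 0"
        using B i finite_subset[OF B] by (simp add: sum.remove[of B i])
      then show "\<gamma> i = 0" using \<open>coord_inner D \<theta> (t i) < 0\<close> by simp
    qed
  next
    fix C and \<mu> :: "nat \<Rightarrow> real" assume C: "C \<subseteq> {..<N}" "2 \<le> card C" and \<mu>: "\<And>i. i \<in> C \<Longrightarrow> \<mu> i \<noteq> 0"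
      and rel: "\<And>m. m < k \<Longrightarrow> (\<Sum>i\<in>C. \<mu> i * a i m) = 0"
    \<comment> \<open>In the Lawrence polytope of the \<open>a i\<close>, \<open>?u ` C\<close> and \<open>?V - ?u ` C\<close> are the two sides of a Radon partition.\<close>
    let ?u = "\<lambda>i. if \<mu> i > 0 then Suc i else Suc (N + i)"
    let ?V = "label_pairs N C"
    have "C \<noteq> {}" "finite C" using C finite_subset by auto
    have V: "?V \<in> lawrence_faces k N a" using C by (intro label_pairs_in_lawrence_faces)
    have "finite ?V" using \<open>finite C\<close> by (simp add: label_pairs_def)
    have V12: "?V \<subseteq> {1..2 * N}" using V by (simp add: lawrence_faces_def)
    have "inj_on ?u C" using C by (auto simp: inj_on_def split: if_splits)
    then have "2 \<le> card (?u ` C)" using C(2) by (simp only: card_image)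
    moreover have "?u ` C \<subseteq> ?V" by (auto simp: label_pairs_def)
    moreover have "?u ` C \<notin> lawrence_faces k N a"
      using positive_part_not_in_lawrence_faces[of C N \<mu> k a] C \<open>C \<noteq> {}\<close> \<mu> rel by blast
    ultimately have no_dual: "\<nexists>\<psi>. \<forall>j\<in>?V. \<forall>l\<in>?V. coord_inner D (\<psi> j) (z l) = of_bool (l = j)"
      using subface[OF V] by blast
    have "(\<exists>c. (\<forall>l\<in>?V. c l \<in> K) \<and> (\<exists>l\<in>?V. c l \<noteq> 0) \<and> (\<forall>m<D. (\<Sum>l\<in>?V. c l * z l m) = 0)) \<or>
      (\<exists>\<psi>. \<forall>j\<in>?V. (\<forall>m<D. \<psi> j m \<in> K) \<and> (\<forall>l\<in>?V. coord_inner D (\<psi> j) (z l) = of_bool (l = j)))"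
      using zK V12 \<open>finite ?V\<close> by (intro dependent_or_dual_functionals[OF K]) auto
    then obtain c where c: "\<forall>l\<in>?V. c l \<in> K" "\<exists>l\<in>?V. c l \<noteq> 0" "\<forall>m<D. (\<Sum>l\<in>?V. c l * z l m) = 0"
      using no_dual by blast
    have c0: "(\<Sum>i\<in>C. c (Suc i) * z (Suc i) m + c (Suc (N + i)) * z (Suc (N + i)) m) = 0" if "m < D" for m
      using c(3) that C by (simp add: sum_label_pairs)
    have cy: "c (Suc (N + i)) = - \<rho> i * c (Suc i)" if i: "i \<in> C" for i
    proof -
      have "i < N" using C i by auto
      have "0 = (\<Sum>m<D. \<phi> i m * (\<Sum>j\<in>C. c (Suc j) * z (Suc j) m + c (Suc (N + j)) * z (Suc (N + j)) m))"
        using c0 by simp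
      also have "\<dots> = (\<Sum>j\<in>C. c (Suc j) * coord_inner D (\<phi> i) (z (Suc j)) +
          c (Suc (N + j)) * coord_inner D (\<phi> i) (z (Suc (N + j))))"
        unfolding coord_inner_def sum_distrib_left sum.distrib[symmetric]
        by (subst sum.swap) (simp add: algebra_simps)
      also have "\<dots> = c (Suc i) * coord_inner D (\<phi> i) (z (Suc i)) +
          c (Suc (N + i)) * coord_inner D (\<phi> i) (z (Suc (N + i)))"
      proof -
        have "c (Suc j) * coord_inner D (\<phi> i) (z (Suc j)) +
            c (Suc (N + j)) * coord_inner D (\<phi> i) (z (Suc (N + j))) = 0" if "j \<in> C - {i}" for j
          using \<phi>(3)[OF \<open>i < N\<close>, of j] that C(1) by auto
        then show ?thesis using i \<open>finite C\<close> by (subst sum.remove[of C i]) auto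
      qed
      finally show ?thesis using \<phi>(2)[OF \<open>i < N\<close>] by (simp add: \<rho>_def field_simps)
    qed
    have "\<exists>i\<in>C. c (Suc i) \<noteq> 0" using c(2) cy by (auto simp: label_pairs_def)
    moreover have "\<forall>i\<in>C. c (Suc i) \<in> K" using c(1) by (auto simp: label_pairs_def)
    moreover have "(\<Sum>i\<in>C. c (Suc i) *\<^sub>R t i) = 0"
    proof
      fix m
      have "(\<Sum>i\<in>C. c (Suc i) * t i m) = 0"
      proof (cases "m < D")
        case True
        have "(\<Sum>i\<in>C. c (Suc i) * t i m) = (\<Sum>i\<in>C. c (Suc i) * z (Suc i) m + c (Suc (N + i)) * z (Suc (N + i)) m)"
          using True cy by (intro sum.cong) (auto simp: t_def algebra_simps)
        then show ?thesis using c0[OF True] by simp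
      qed (simp add: t_def)
      then show "(\<Sum>i\<in>C. c (Suc i) *\<^sub>R t i) m = 0 m" by (simp add: sum_t)
    qed
    ultimately show "\<exists>\<alpha>. (\<forall>i\<in>C. \<alpha> i \<in> K) \<and> (\<exists>i\<in>C. \<alpha> i \<noteq> 0) \<and> (\<Sum>i\<in>C. \<alpha> i *\<^sub>R t i) = 0"
      by (intro exI[of _ "\<lambda>i. c (Suc i)"]) auto
  qed
qed

text \<open>
  The points \<open>\<nu>\<^sub>i (\<plusminus> a\<^sub>i, e\<^sub>i)\<close>, where \<open>e\<^sub>i\<close> is the \<open>i\<close>-th unit vector of the last \<open>N\<close> coordinates and
  \<open>\<nu>\<^sub>i\<close> normalizes the length.
\<close>

definition lawrence_points :: "nat \<Rightarrow> nat \<Rightarrow> (nat \<Rightarrow> nat \<Rightarrow> real) \<Rightarrow> nat \<Rightarrow> nat \<Rightarrow> real" where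
  "lawrence_points k N a l = (let i = (l - 1) mod N; \<nu> = 1 / sqrt (1 + coord_inner k (a i) (a i)) in
     (\<lambda>m. if m < k then (if l \<le> N then \<nu> else - \<nu>) * a i m else if m = k + i then \<nu> else 0))"

lemma label_cases:
  assumes "l \<in> {1..2 * N}"
  obtains i where "i < N" "l = Suc i" | i where "i < N" "l = Suc (N + i)"
proof (cases "l \<le> N")
  case True
  then show ?thesis using assms that(1)[of "l - 1"] by auto
next
  case False
  then show ?thesis using assms that(2)[of "l - N - 1"] by auto
qed

lemma coord_inner_add_dimension:
  "coord_inner (k + N) x y = coord_inner k x y + (\<Sum>i<N. x (k + i) * y (k + i))"
  by (induction N) (simp_all add: coord_inner_def)

text \<open>
  A functional \<open>C\<close> splits into its part \<open>c\<close> on the first \<open>k\<close> coordinates and arbitrary values on the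
  last \<open>N\<close>. At the \<open>i\<close>-th pair the inequality with bound \<open>b\<close> reads \<open>\<plusminus> c \<bullet> a i \<le> b / \<nu> i - C (k + i)\<close>,
  and the right-hand side plays the role of \<open>h i\<close>.
\<close>

lemma lawrence_points_inscribed:
  assumes a: "\<And>i. i < N \<Longrightarrow> \<exists>m<k. a i m \<noteq> 0"
  shows "inscribed_polytope (k + N) (2 * N) (lawrence_points k N a)"
    and "face_lattice (k + N) (2 * N) (lawrence_points k N a) = lawrence_faces k N a"
proof -
  let ?v = "lawrence_points k N a"
  define \<nu> where "\<nu> i = 1 / sqrt (1 + coord_inner k (a i) (a i))" for i
  have \<nu>: "\<nu> i > 0" for i
    using coord_inner_nonneg[of k "a i"] by (simp add: \<nu>_def)
  have \<nu>2: "(\<nu> i)\<^sup>2 * (1 + coord_inner k (a i) (a i)) = 1" for i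
    using coord_inner_nonneg[of k "a i"] by (simp add: \<nu>_def power_divide)
  have x: "?v (Suc i) = (\<lambda>m. if m < k then \<nu> i * a i m else if m = k + i then \<nu> i else 0)"
    and y: "?v (Suc (N + i)) = (\<lambda>m. if m < k then - \<nu> i * a i m else if m = k + i then \<nu> i else 0)"
    if "i < N" for i
    using that by (simp_all add: lawrence_points_def \<nu>_def Let_def fun_eq_iff)
  have inner_x: "coord_inner (k + N) C (?v (Suc i)) = \<nu> i * (coord_inner k C (a i) + C (k + i))"
    and inner_y: "coord_inner (k + N) C (?v (Suc (N + i))) = \<nu> i * (- coord_inner k C (a i) + C (k + i))"
    if "i < N" for i C
    using that unfolding coord_inner_add_dimension x[OF that] y[OF that]
    by (simp_all add: coord_inner_def sum_negf sum_distrib_left algebra_simps if_distrib[of "\<lambda>x. _ * x"] cong: if_cong)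
  have ne: "?v (Suc i) \<noteq> ?v (Suc j)" "?v (Suc (N + i)) \<noteq> ?v (Suc (N + j))" if "i < N" "j < N" "i \<noteq> j" for i j
    using that \<nu>[of i] by (auto simp: x y fun_eq_iff intro!: exI[of _ "k + i"])
  have ne': "?v (Suc i) \<noteq> ?v (Suc (N + j))" if ij: "i < N" "j < N" for i j
  proof (cases "i = j")
    case True
    obtain m where "m < k" "a i m \<noteq> 0" using a ij by blast
    then show ?thesis using True \<nu>[of i] ij by (auto simp: x y fun_eq_iff intro!: exI[of _ m])
  next
    case False
    then show ?thesis using ij \<nu>[of i] by (auto simp: x y fun_eq_iff intro!: exI[of _ "k + i"])
  qed
  have "inj_on ?v {1..2 * N}"
  proof (rule inj_onI)
    fix l l' assume "l \<in> {1..2 * N}" "l' \<in> {1..2 * N}" "?v l = ?v l'"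
    then show "l = l'"
      using ne ne' by (elim label_cases) (metis+)
  qed
  moreover have "?v l \<in> coord_space (k + N)" if "l \<in> {1..2 * N}" for l
    using that by (elim label_cases) (auto simp: coord_space_iff x y)
  ultimately have "point_configuration (k + N) (2 * N) ?v" by (auto simp: point_configuration_def)
  moreover have "coord_inner (k + N) (?v l) (?v l) = 1" if "l \<in> {1..2 * N}" for l
  proof -
    have *: "coord_inner k (?v (Suc i)) (a i) = \<nu> i * coord_inner k (a i) (a i)"
      "coord_inner k (?v (Suc (N + i))) (a i) = - \<nu> i * coord_inner k (a i) (a i)" if "i < N" for i
      using that by (simp_all add: x y coord_inner_def sum_distrib_left sum_negf mult_ac)
    show ?thesis
      using that
    proof (cases rule: label_cases)
      case (1 i)
      then show ?thesis using inner_x[of i "?v l"] *[of i] \<nu>2[of i]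
        by (simp add: x power2_eq_square algebra_simps)
    next
      case (2 i)
      then show ?thesis using inner_y[of i "?v l"] *[of i] \<nu>2[of i]
        by (simp add: y power2_eq_square algebra_simps)
    qed
  qed
  ultimately show ins: "inscribed_polytope (k + N) (2 * N) ?v" by (rule unit_points_inscribed_polytope)
  then have lp: "labeled_polytope (k + N) (2 * N) ?v" by (simp add: inscribed_polytope_def)
  show "face_lattice (k + N) (2 * N) ?v = lawrence_faces k N a"
  proof (intro equalityI subsetI)
    fix S assume "S \<in> face_lattice (k + N) (2 * N) ?v"
    then obtain C b where S: "S \<subseteq> {1..2 * N}" and on: "\<forall>l\<in>S. coord_inner (k + N) C (?v l) = b"
      and off: "\<forall>l\<in>{1..2 * N} - S. coord_inner (k + N) C (?v l) < b"
      unfolding face_lattice_iff[OF lp] by blast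
    have le: "coord_inner (k + N) C (?v l) \<le> b" and mem: "l \<in> S \<longleftrightarrow> coord_inner (k + N) C (?v l) = b"
      if "l \<in> {1..2 * N}" for l
      using on off that by (cases "l \<in> S"; force)+
    define h where "h i = b / \<nu> i - C (k + i)" for i
    have xl: "coord_inner k C (a i) \<le> h i" "Suc i \<in> S \<longleftrightarrow> h i = coord_inner k C (a i)" if "i < N" for i
      using le[of "Suc i"] mem[of "Suc i"] inner_x[OF that, of C] that \<nu>[of i] by (auto simp: h_def field_simps)
    have yl: "- coord_inner k C (a i) \<le> h i" "Suc (N + i) \<in> S \<longleftrightarrow> h i = - coord_inner k C (a i)" if "i < N" for i
      using le[of "Suc (N + i)"] mem[of "Suc (N + i)"] inner_y[OF that, of C] that \<nu>[of i]
      by (auto simp: h_def field_simps)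
    show "S \<in> lawrence_faces k N a"
      using xl yl by (intro lawrence_facesI[where c = C and h = h] S) (auto simp: abs_le_iff)
  next
    fix S assume "S \<in> lawrence_faces k N a"
    then obtain c h where S: "S \<subseteq> {1..2 * N}" and ch: "\<And>i. i < N \<Longrightarrow> \<bar>coord_inner k c (a i)\<bar> \<le> h i"
      "\<And>i. i < N \<Longrightarrow> Suc i \<in> S \<longleftrightarrow> h i = coord_inner k c (a i)"
      "\<And>i. i < N \<Longrightarrow> Suc (N + i) \<in> S \<longleftrightarrow> h i = - coord_inner k c (a i)"
      unfolding lawrence_faces_def by blast
    \<comment> \<open>The last coordinates of \<open>C\<close> are free, so the bound may be taken to be 0.\<close>
    define C where "C m = (if m < k then c m else if m < k + N then - h (m - k) else 0)" for m
    have C: "C \<in> coord_space (k + N)" by (simp add: coord_space_iff C_def)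
    have Ck: "coord_inner k C u = coord_inner k c u" for u by (simp add: coord_inner_def C_def)
    have le: "coord_inner (k + N) C (?v l) \<le> 0 \<and> (l \<in> S \<longleftrightarrow> coord_inner (k + N) C (?v l) = 0)"
      if "l \<in> {1..2 * N}" for l
      using that
    proof (cases rule: label_cases)
      case (1 i)
      have "coord_inner (k + N) C (?v l) = \<nu> i * (coord_inner k c (a i) - h i)"
        unfolding 1(2) inner_x[OF 1(1)] Ck using 1(1) by (simp add: C_def)
      moreover have "coord_inner k c (a i) - h i \<le> 0" using ch(1)[OF 1(1)] by linarith
      ultimately show ?thesis
        using ch(2)[OF 1(1)] \<nu>[of i] unfolding 1(2) by (auto simp: mult_le_0_iff)
    next
      case (2 i)
      have "coord_inner (k + N) C (?v l) = \<nu> i * (- coord_inner k c (a i) - h i)"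
        unfolding 2(2) inner_y[OF 2(1)] Ck using 2(1) by (simp add: C_def)
      moreover have "- coord_inner k c (a i) - h i \<le> 0" using ch(1)[OF 2(1)] by linarith
      ultimately show ?thesis
        using ch(3)[OF 2(1)] \<nu>[of i] unfolding 2(2) by (auto simp: mult_le_0_iff)
    qed
    have "\<forall>l\<in>S. coord_inner (k + N) C (?v l) = 0" using le S by blast
    moreover have "\<forall>l\<in>{1..2 * N} - S. coord_inner (k + N) C (?v l) < 0" using le by force
    ultimately show "S \<in> face_lattice (k + N) (2 * N) ?v"
      using S C by (intro face_latticeI[OF lp, of S C 0]) auto
  qed
qed

section \<open>A configuration that forces a root of 2\<close>

text \<open>
  For pairwise independent vectors this is the collinearity of the three points that they represent
  in projective space, witnessed by coefficients in \<open>K\<close>.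
\<close>

definition dependent_triple :: "real set \<Rightarrow> 'v::real_vector \<Rightarrow> 'v \<Rightarrow> 'v \<Rightarrow> bool" where
  "dependent_triple K u v w \<longleftrightarrow>
     (\<exists>\<alpha>\<in>K - {0}. \<exists>\<beta>\<in>K - {0}. \<exists>\<gamma>\<in>K - {0}. \<alpha> *\<^sub>R u + \<beta> *\<^sub>R v + \<gamma> *\<^sub>R w = 0)"

lemma dependent_triple_combination:
  assumes K: "real_subfield K" and "dependent_triple K u v w"
  obtains p q where "p \<in> K" "q \<in> K" "p \<noteq> 0" "q \<noteq> 0" "w = p *\<^sub>R u + q *\<^sub>R v"
proof -
  from assms(2) obtain \<alpha> \<beta> \<gamma> where *: "\<alpha> \<in> K" "\<beta> \<in> K" "\<gamma> \<in> K" "\<alpha> \<noteq> 0" "\<beta> \<noteq> 0" "\<gamma> \<noteq> 0"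
    and "\<alpha> *\<^sub>R u + \<beta> *\<^sub>R v + \<gamma> *\<^sub>R w = 0" by (auto simp: dependent_triple_def)
  then have "\<gamma> *\<^sub>R w = (- \<alpha>) *\<^sub>R u + (- \<beta>) *\<^sub>R v" by (simp add: add_eq_0_iff)
  then have "(1 / \<gamma>) *\<^sub>R \<gamma> *\<^sub>R w = (1 / \<gamma>) *\<^sub>R ((- \<alpha>) *\<^sub>R u + (- \<beta>) *\<^sub>R v)" by simp
  then have "w = (- \<alpha> / \<gamma>) *\<^sub>R u + (- \<beta> / \<gamma>) *\<^sub>R v" 
    using * by (simp add: scaleR_right_distrib scaleR_right_diff_distrib)
  moreover have "- \<alpha> / \<gamma> \<in> K" "- \<beta> / \<gamma> \<in> K"
    using * by (auto intro!: real_subfield_closed[OF K])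
  ultimately show ?thesis using * by (intro that[of "- \<alpha> / \<gamma>" "- \<beta> / \<gamma>"]) auto
qed

text \<open>
  In coordinates with respect to \<open>e, f, g\<close>, let \<open>P j\<close> have slope \<open>p j\<close> in the plane of \<open>e, f\<close>, and
  let \<open>Q j\<close> have slope \<open>q j\<close> in the plane of \<open>e, g\<close>. The incidences with \<open>R\<^sub>0\<close> and \<open>R\<^sub>1\<close> express \<open>q j\<close>
  and \<open>q (Suc j)\<close> as fixed multiples of \<open>p j\<close>, so the \<open>p j\<close> form a geometric progression, whose ratio
  \<open>y\<close> is a cross ratio in \<open>K\<close>. The point \<open>S\<close> adds \<open>p 0\<close> to itself, which gives \<open>p m = 2 * p 0\<close>.
\<close>

lemma incidences_force_root_of_2:
  fixes e f g R\<^sub>0 R\<^sub>1 S :: "'v::real_vector" and P Q :: "nat \<Rightarrow> 'v"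
  assumes K: "real_subfield K"
    and indep: "\<And>a b c. a *\<^sub>R e + b *\<^sub>R f + c *\<^sub>R g = 0 \<Longrightarrow> a = 0 \<and> b = 0 \<and> c = 0"
    and P: "\<And>j. j \<le> m \<Longrightarrow> dependent_triple K e f (P j)"
    and Q: "\<And>j. j \<le> m \<Longrightarrow> dependent_triple K e g (Q j)"
    and R: "dependent_triple K f g R\<^sub>0" "dependent_triple K f g R\<^sub>1"
    and PQ: "\<And>j. j \<le> m \<Longrightarrow> dependent_triple K (P j) R\<^sub>0 (Q j)"
    and step: "\<And>j. j < m \<Longrightarrow> dependent_triple K (P j) R\<^sub>1 (Q (Suc j))"
    and S: "dependent_triple K (P 0) g S" "dependent_triple K (Q 0) f S" "dependent_triple K S R\<^sub>0 (P m)"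
  shows "\<exists>y\<in>K. y ^ m = 2"
proof -
  have cmp: "a = a' \<and> b = b' \<and> c = c'"
    if "a *\<^sub>R e + b *\<^sub>R f + c *\<^sub>R g = a' *\<^sub>R e + b' *\<^sub>R f + c' *\<^sub>R g" for a b c a' b' c'
  proof -
    have "(a - a') *\<^sub>R e + (b - b') *\<^sub>R f + (c - c') *\<^sub>R g =
        (a *\<^sub>R e + b *\<^sub>R f + c *\<^sub>R g) - (a' *\<^sub>R e + b' *\<^sub>R f + c' *\<^sub>R g)"
      by (simp add: algebra_simps)
    then have "a - a' = 0 \<and> b - b' = 0 \<and> c - c' = 0" using that by (intro indep) simp
    then show ?thesis by simp
  qed
  have "\<exists>p q. p \<in> K \<and> q \<in> K \<and> p \<noteq> 0 \<and> q \<noteq> 0 \<and> P j = p *\<^sub>R e + q *\<^sub>R f" if "j \<le> m" for j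
    using dependent_triple_combination[OF K P[OF that]] by metis
  then obtain p p' where p: "\<And>j. j \<le> m \<Longrightarrow> p j \<noteq> 0 \<and> p' j \<noteq> 0 \<and> P j = p j *\<^sub>R e + p' j *\<^sub>R f"
    by metis
  have "\<exists>p q. p \<in> K \<and> q \<in> K \<and> p \<noteq> 0 \<and> q \<noteq> 0 \<and> Q j = p *\<^sub>R e + q *\<^sub>R g" if "j \<le> m" for j
    using dependent_triple_combination[OF K Q[OF that]] by metis
  then obtain q q' where q: "\<And>j. j \<le> m \<Longrightarrow> q j \<noteq> 0 \<and> q' j \<noteq> 0 \<and> Q j = q j *\<^sub>R e + q' j *\<^sub>R g"
    by metis
  obtain r r' where r: "r \<in> K" "r' \<in> K" "r \<noteq> 0" "r' \<noteq> 0" "R\<^sub>0 = r *\<^sub>R f + r' *\<^sub>R g"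
    using dependent_triple_combination[OF K R(1)] by metis
  obtain s s' where s: "s \<in> K" "s' \<in> K" "s \<noteq> 0" "s' \<noteq> 0" "R\<^sub>1 = s *\<^sub>R f + s' *\<^sub>R g"
    using dependent_triple_combination[OF K R(2)] by metis
  have transfer: "q' l / q l = - (t' / t) * (p' j / p j)"
    if jl: "j \<le> m" "l \<le> m" and t: "t \<noteq> 0" and dep: "dependent_triple K (P j) (t *\<^sub>R f + t' *\<^sub>R g) (Q l)" for j l t t'
  proof -
    obtain a b where ab: "a \<noteq> 0" "Q l = a *\<^sub>R P j + b *\<^sub>R (t *\<^sub>R f + t' *\<^sub>R g)"
      using dependent_triple_combination[OF K dep] by metis
    then have "q l *\<^sub>R e + 0 *\<^sub>R f + q' l *\<^sub>R g = (a * p j) *\<^sub>R e + (a * p' j + b * t) *\<^sub>R f + (b * t') *\<^sub>R g"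
      using p[OF jl(1)] q[OF jl(2)] by (simp add: algebra_simps)
    from cmp[OF this] have "q l = a * p j" "b * t = - (a * p' j)" "q' l = b * t'" by auto
    then have "b = - (a * p' j) / t" using t by (simp add: field_simps)
    have "q' l / q l = (- (a * p' j) / t * t') / (a * p j)"
      unfolding \<open>q l = a * p j\<close> \<open>q' l = b * t'\<close> \<open>b = - (a * p' j) / t\<close> ..
    then show ?thesis using ab(1) by (simp add: ac_simps)
  qed
  have same: "q' j / q j = - (r' / r) * (p' j / p j)" if "j \<le> m" for j
    using transfer[OF that that r(3)] PQ[OF that] r(5) by simp
  have succ: "q' (Suc j) / q (Suc j) = - (s' / s) * (p' j / p j)" if "j < m" for j
    using transfer[of j "Suc j" s s'] that s step[OF that] by simp
  define y where "y = (s' / s) / (r' / r)"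
  have "y \<in> K" unfolding y_def using r s by (intro real_subfield_closed[OF K])
  have ratio: "p' j / p j = (p' 0 / p 0) * y ^ j" if "j \<le> m" for j
    using that
  proof (induction j)
    case (Suc j)
    have "- (r' / r) * (p' (Suc j) / p (Suc j)) = - (s' / s) * (p' j / p j)"
      using same[OF Suc.prems] succ[of j] Suc.prems by simp
    then have "(r' / r) * (p' (Suc j) / p (Suc j)) = (r' / r) * ((p' j / p j) * y)"
      using r(3,4) by (simp add: y_def mult.commute)
    then have "p' (Suc j) / p (Suc j) = (p' j / p j) * y"
      using r(3,4) by (subst (asm) mult_cancel_left) simp
    then show ?case using Suc by simp
  qed simp
  have "p' m / p m = 2 * (p' 0 / p 0)"
  proof -
    obtain a b where a: "a \<noteq> 0" "S = a *\<^sub>R P 0 + b *\<^sub>R g"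
      using dependent_triple_combination[OF K S(1)] by metis
    obtain a' b' where a': "a' \<noteq> 0" "S = a' *\<^sub>R Q 0 + b' *\<^sub>R f"
      using dependent_triple_combination[OF K S(2)] by metis
    obtain c d where c: "c \<noteq> 0" "P m = c *\<^sub>R S + d *\<^sub>R R\<^sub>0"
      using dependent_triple_combination[OF K S(3)] by metis
    have "(a * p 0) *\<^sub>R e + (a * p' 0) *\<^sub>R f + b *\<^sub>R g = (a' * q 0) *\<^sub>R e + b' *\<^sub>R f + (a' * q' 0) *\<^sub>R g"
      using a a' p[of 0] q[of 0] by (simp add: algebra_simps)
    from cmp[OF this] have b: "b = a' * q' 0" "a' * q 0 = a * p 0" by auto
    have "b = a * p 0 * (q' 0 / q 0)" using b q[of 0] by (simp add: field_simps)
    then have b: "b = - (a * p' 0 * (r' / r))" using same[of 0] p[of 0] by simp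
    have "p m *\<^sub>R e + p' m *\<^sub>R f + 0 *\<^sub>R g =
        (c * (a * p 0)) *\<^sub>R e + (c * (a * p' 0) + d * r) *\<^sub>R f + (c * b + d * r') *\<^sub>R g"
      using c(2) a(2) r(5) p[of 0] p[of m] by (simp add: algebra_simps)
    from cmp[OF this] have m: "p m = c * (a * p 0)" "p' m = c * (a * p' 0) + d * r" "d * r' = - (c * b)"
      by auto
    have "d * r' = (c * a * p' 0 / r) * r'" using m(3) b by simp
    then have "d = c * a * p' 0 / r" using r(4) by (simp only: mult_cancel_right) simp
    then have "p' m = 2 * (c * (a * p' 0))" using m(2) r(3) by simp
    then show ?thesis using m(1) by (simp add: c a)
  qed
  then have "y ^ m = 2" using ratio[of m] p[of 0] by simp
  then show ?thesis using \<open>y \<in> K\<close> by blast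
qed

definition vec3 :: "real \<Rightarrow> real \<Rightarrow> real \<Rightarrow> nat \<Rightarrow> real" where
  "vec3 p q r = (\<lambda>m. if m = 0 then p else if m = 1 then q else if m = 2 then r else 0)"

lemma vec3_nth [simp]:
  "vec3 p q r 0 = p" "vec3 p q r 1 = q" "vec3 p q r (Suc 0) = q" "vec3 p q r 2 = r"
  by (simp_all add: vec3_def)

lemma coord_inner_vec3: "coord_inner 3 c (vec3 p q r) = c 0 * p + c 1 * q + c 2 * r"
  by (simp add: coord_inner_def numeral_3_eq_3 numeral_2_eq_2 vec3_def)

definition parallel3 :: "(nat \<Rightarrow> real) \<Rightarrow> (nat \<Rightarrow> real) \<Rightarrow> bool" where
  "parallel3 u v \<longleftrightarrow> u 0 * v 1 = u 1 * v 0 \<and> u 0 * v 2 = u 2 * v 0 \<and> u 1 * v 2 = u 2 * v 1"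

lemma parallel3_sym: "parallel3 u v \<longleftrightarrow> parallel3 v u"
  by (auto simp: parallel3_def mult.commute)

text \<open>
  The component of \<open>u\<close> orthogonal to \<open>v\<close>, scaled by \<open>\<parallel>v\<parallel>\<^sup>2\<close>. Its inner product with \<open>u\<close> is the Gram
  determinant of \<open>u, v\<close>, which is the squared length of their cross product.
\<close>

lemma separating_covector:
  assumes "\<not> parallel3 u v"
  shows "\<exists>c. coord_inner 3 c u > 0 \<and> coord_inner 3 c v = 0"
proof -
  have inner: "coord_inner 3 x w = x 0 * w 0 + x 1 * w 1 + x 2 * w 2" for x w
    by (simp add: coord_inner_def numeral_3_eq_3 numeral_2_eq_2)
  define c where "c m = coord_inner 3 v v * u m - coord_inner 3 u v * v m" for m
  have "coord_inner 3 c u = (u 0 * v 1 - u 1 * v 0)\<^sup>2 + (u 0 * v 2 - u 2 * v 0)\<^sup>2 + (u 1 * v 2 - u 2 * v 1)\<^sup>2"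
    unfolding c_def inner by (simp add: power2_eq_square algebra_simps)
  also have "\<dots> > 0"
    using assms unfolding parallel3_def
    by (smt (verit) zero_le_power2 zero_less_power2)
  finally have "coord_inner 3 c u > 0" .
  moreover have "coord_inner 3 c v = 0" unfolding c_def inner by (simp add: algebra_simps)
  ultimately show ?thesis by blast
qed

text \<open>
  A configuration with the incidences of the lemma \<open>incidences_force_root_of_2\<close>, when \<open>x ^ m = 2\<close>. The
  indices 0 to 5 stand for \<open>e, f, g, R\<^sub>0, R\<^sub>1, S\<close>, the index \<open>6 + 2 * j\<close> for \<open>P j\<close> and \<open>7 + 2 * j\<close>
  for \<open>Q j\<close>. As \<open>j\<close> ranges up to \<open>m\<close>, there are \<open>8 + 2 * m\<close> vectors.
\<close>

definition root_configuration :: "real \<Rightarrow> nat \<Rightarrow> nat \<Rightarrow> real" where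
  "root_configuration x i =
     (if i = 0 then vec3 1 0 0 else if i = 1 then vec3 0 1 0 else if i = 2 then vec3 0 0 1
      else if i = 3 then vec3 0 1 (- 1) else if i = 4 then vec3 0 1 (- x) else if i = 5 then vec3 1 (- 1) (- 1)
      else if even i then vec3 1 (- (x ^ ((i - 6) div 2))) 0 else vec3 1 0 (- (x ^ ((i - 6) div 2))))"

lemma root_configuration_simps:
  "root_configuration x 0 = vec3 1 0 0"
  "root_configuration x 1 = vec3 0 1 0"
  "root_configuration x (Suc 0) = vec3 0 1 0"
  "root_configuration x 2 = vec3 0 0 1"
  "root_configuration x 3 = vec3 0 1 (- 1)"
  "root_configuration x 4 = vec3 0 1 (- x)"
  "root_configuration x 5 = vec3 1 (- 1) (- 1)"
  "root_configuration x (6 + 2 * j) = vec3 1 (- (x ^ j)) 0"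
  "root_configuration x (7 + 2 * j) = vec3 1 0 (- (x ^ j))"
  by (simp_all add: root_configuration_def)

text \<open>
  The incidences of the root configuration are dependencies of three pairwise nonparallel vectors.
  Nonparallel vectors remain independent in a realization, so the transferred dependencies have no
  vanishing coefficient, and the incidence lemma applies.
\<close>

lemma lawrence_root_configuration_not_realizable:
  assumes K: "real_subfield K" and x: "x ^ m = 2" "x > 0" and noroot: "\<And>y. y \<in> K \<Longrightarrow> y ^ m \<noteq> 2"
    and N: "N = 8 + 2 * m"
  shows "\<not> vector_realization K D (2 * N) (lawrence_faces 3 N (root_configuration x)) z"
proof
  let ?a = "root_configuration x"
  assume z: "vector_realization K D (2 * N) (lawrence_faces 3 N ?a) z"
  obtain t :: "nat \<Rightarrow> nat \<Rightarrow> real" where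
    free: "\<And>B \<gamma>. B \<subseteq> {..<N} \<Longrightarrow>
      (\<And>i. i \<in> B \<Longrightarrow> \<exists>c. coord_inner 3 c (?a i) > 0 \<and> (\<forall>j\<in>B - {i}. coord_inner 3 c (?a j) = 0)) \<Longrightarrow>
      (\<Sum>i\<in>B. \<gamma> i *\<^sub>R t i) = 0 \<Longrightarrow> \<forall>i\<in>B. \<gamma> i = 0"
    and relation: "\<And>C \<mu>. C \<subseteq> {..<N} \<Longrightarrow> 2 \<le> card C \<Longrightarrow> (\<And>i. i \<in> C \<Longrightarrow> \<mu> i \<noteq> 0) \<Longrightarrow>
      (\<And>m. m < 3 \<Longrightarrow> (\<Sum>i\<in>C. \<mu> i * ?a i m) = 0) \<Longrightarrow>
      \<exists>\<alpha>. (\<forall>i\<in>C. \<alpha> i \<in> K) \<and> (\<exists>i\<in>C. \<alpha> i \<noteq> 0) \<and> (\<Sum>i\<in>C. \<alpha> i *\<^sub>R t i) = 0"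
    using lawrence_realization_vectors[OF K z] by blast
  have pair: "\<alpha> = 0 \<and> \<beta> = 0"
    if ij: "i < N" "j < N" "\<not> parallel3 (?a i) (?a j)" and zero: "\<alpha> *\<^sub>R t i + \<beta> *\<^sub>R t j = 0" for i j \<alpha> \<beta>
  proof -
    have ne: "i \<noteq> j" using ij(3) by (auto simp: parallel3_def mult.commute)
    have "\<forall>l\<in>{i, j}. (if l = i then \<alpha> else \<beta>) = 0"
    proof (rule free)
      fix l assume "l \<in> {i, j}"
      then show "\<exists>c. coord_inner 3 c (?a l) > 0 \<and> (\<forall>j\<in>{i, j} - {l}. coord_inner 3 c (?a j) = 0)"
        using separating_covector[OF ij(3)] separating_covector[of "?a j" "?a i"] ij(3) ne
        by (auto simp: parallel3_sym insert_Diff_if)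
    qed (use ij ne zero in auto)
    then show ?thesis using ne by auto
  qed
  have triple: "dependent_triple K (t i) (t j) (t l)"
    if ijl: "i < N" "j < N" "l < N"
      and np: "\<not> parallel3 (?a i) (?a j)" "\<not> parallel3 (?a i) (?a l)" "\<not> parallel3 (?a j) (?a l)"
      and rel: "\<alpha> \<noteq> 0" "\<beta> \<noteq> 0" "\<gamma> \<noteq> 0" "\<forall>m<3. \<alpha> * ?a i m + \<beta> * ?a j m + \<gamma> * ?a l m = 0" for i j l \<alpha> \<beta> \<gamma>
  proof -
    have ne: "i \<noteq> j" "i \<noteq> l" "j \<noteq> l" using np by (auto simp: parallel3_def mult.commute)
    have "\<exists>\<alpha>. (\<forall>i\<in>{i, j, l}. \<alpha> i \<in> K) \<and> (\<exists>i\<in>{i, j, l}. \<alpha> i \<noteq> 0) \<and> (\<Sum>i\<in>{i, j, l}. \<alpha> i *\<^sub>R t i) = 0"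
      using ijl ne rel by (intro relation[where \<mu> = "\<lambda>h. if h = i then \<alpha> else if h = j then \<beta> else \<gamma>"])
        (auto simp: add.assoc)
    then obtain \<delta> where \<delta>: "\<delta> i \<in> K" "\<delta> j \<in> K" "\<delta> l \<in> K" "\<delta> i \<noteq> 0 \<or> \<delta> j \<noteq> 0 \<or> \<delta> l \<noteq> 0"
      and sum: "\<delta> i *\<^sub>R t i + \<delta> j *\<^sub>R t j + \<delta> l *\<^sub>R t l = 0"
      using ne by (auto simp: add.assoc)
    have "\<delta> i \<noteq> 0"
      using pair[OF ijl(2,3) np(3), of "\<delta> j" "\<delta> l"] sum \<delta>(4) by auto
    moreover have "\<delta> j \<noteq> 0"
      using pair[OF ijl(1,3) np(2), of "\<delta> i" "\<delta> l"] sum \<delta>(4) by auto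
    moreover have "\<delta> l \<noteq> 0"
      using pair[OF ijl(1,2) np(1), of "\<delta> i" "\<delta> j"] sum \<delta>(4) by auto
    ultimately show ?thesis using \<delta> sum unfolding dependent_triple_def by blast
  qed
  have coords: "(\<forall>m<3. F m) \<longleftrightarrow> F 0 \<and> F 1 \<and> F (2::nat)" for F
    by (auto simp: numeral_3_eq_3 numeral_2_eq_2 less_Suc_eq)
  note evaluate = root_configuration_simps parallel3_def coords vec3_nth
  have "\<exists>y\<in>K. y ^ m = 2"
  proof (rule incidences_force_root_of_2[OF K, where e = "t 0" and f = "t 1" and g = "t 2" and
        R\<^sub>0 = "t 3" and R\<^sub>1 = "t 4" and S = "t 5" and P = "\<lambda>j. t (6 + 2 * j)" and Q = "\<lambda>j. t (7 + 2 * j)"])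
    fix a b c assume abc: "a *\<^sub>R t 0 + b *\<^sub>R t 1 + c *\<^sub>R t 2 = 0"
    let ?\<gamma> = "\<lambda>i::nat. if i = 0 then a else if i = 1 then b else c"
    have "\<forall>i\<in>{0, 1, 2}. ?\<gamma> i = 0"
    proof (rule free)
      fix i :: nat assume "i \<in> {0, 1, 2}"
      then show "\<exists>c. coord_inner 3 c (?a i) > 0 \<and> (\<forall>j\<in>{0, 1, 2} - {i}. coord_inner 3 c (?a j) = 0)"
        by (intro exI[of _ "?a i"]) (auto simp: root_configuration_simps coord_inner_vec3 simp del: One_nat_def)
    qed (use abc in \<open>auto simp: N add.assoc\<close>)
    then show "a = 0 \<and> b = 0 \<and> c = 0" by auto
  next
    fix j assume "j \<le> m"
    then show "dependent_triple K (t 0) (t 1) (t (6 + 2 * j))"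
      using x by (intro triple[of 0 1 "6 + 2 * j" 1 "- (x ^ j)" "- 1"]) (auto simp: evaluate N)
    show "dependent_triple K (t 0) (t 2) (t (7 + 2 * j))"
      using x \<open>j \<le> m\<close> by (intro triple[of 0 2 "7 + 2 * j" 1 "- (x ^ j)" "- 1"]) (auto simp: evaluate N)
    show "dependent_triple K (t (6 + 2 * j)) (t 3) (t (7 + 2 * j))"
      using x \<open>j \<le> m\<close> by (intro triple[of "6 + 2 * j" 3 "7 + 2 * j" 1 "x ^ j" "- 1"]) (auto simp: evaluate N)
  next
    fix j assume "j < m"
    then show "dependent_triple K (t (6 + 2 * j)) (t 4) (t (7 + 2 * Suc j))"
      using x by (intro triple[of "6 + 2 * j" 4 "7 + 2 * Suc j" 1 "x ^ j" "- 1"])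
        (simp_all only: evaluate N, auto)
  next
    show "dependent_triple K (t 1) (t 2) (t 3)"
      by (intro triple[of 1 2 3 1 "- 1" "- 1"]) (auto simp: evaluate N)
    show "dependent_triple K (t 1) (t 2) (t 4)"
      using x by (intro triple[of 1 2 4 1 "- x" "- 1"]) (auto simp: evaluate N)
    show "dependent_triple K (t (6 + 2 * 0)) (t 2) (t 5)"
      by (intro triple[of "6 + 2 * 0" 2 5 1 "- 1" "- 1"]) (simp_all only: evaluate N, auto)
    show "dependent_triple K (t (7 + 2 * 0)) (t 1) (t 5)"
      by (intro triple[of "7 + 2 * 0" 1 5 1 "- 1" "- 1"]) (simp_all only: evaluate N, auto)
    show "dependent_triple K (t 5) (t 3) (t (6 + 2 * m))"
      using x by (intro triple[of 5 3 "6 + 2 * m" 1 "- 1" "- 1"]) (simp_all only: evaluate N, auto)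
  qed
  then show False using noroot by blast
qed

theorem corollary3p5:
  fixes F :: "complex set"
  assumes "finite_extension_of_Rats F"
  shows "(\<exists>d n T. d \<ge> 1 \<and>
            (\<exists>A. delaunay_realization d n T A) \<and>
            \<not> (\<exists>A. delaunay_realization d n T A \<and> coordinates_in F d n A)) \<and>
         (\<exists>d n v. d \<ge> 1 \<and> inscribed_polytope d n v \<and>
            \<not> (\<exists>w. inscribed_realization d n v w \<and> coordinates_in F d n w))"
proof -
  obtain m where "0 < m" and noroot: "\<And>y :: real. y ^ m = 2 \<Longrightarrow> complex_of_real y \<notin> F"
    using finite_extension_lacks_root_of_2[OF assms] by blast
  define K where "K = {y. complex_of_real y \<in> F}"
  have K: "real_subfield K"
    using assms by (auto simp: real_subfield_def K_def finite_extension_of_Rats_def of_real_inverse)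
  have coordinates: "A i k \<in> K" if "coordinates_in F d n A" "i \<in> {1..n}" "k < d" for d n A i k
    using that by (simp add: coordinates_in_def K_def)
  define x where "x = root m 2"
  have x: "x ^ m = 2" "x > 0" using \<open>0 < m\<close> by (simp_all add: x_def)
  define N where "N = 8 + 2 * m"
  let ?a = "root_configuration x"
  have not_realizable: "\<not> vector_realization K D (2 * N) (lawrence_faces 3 N ?a) z" for D z
    using noroot by (intro lawrence_root_configuration_not_realizable[OF K x _ N_def]) (auto simp: K_def)
  let ?v = "lawrence_points 3 N ?a" and ?d = "3 + N" and ?T = "lawrence_faces 3 N ?a"
  have "\<exists>k<3. ?a i k \<noteq> 0" for i
    using x by (auto simp: root_configuration_def intro: exI[of _ 0] exI[of _ 1] exI[of _ 2])
  then have v: "inscribed_polytope ?d (2 * N) ?v" and T: "face_lattice ?d (2 * N) ?v = ?T"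
    by (rule lawrence_points_inscribed)+
  have "delaunay_realization ?d (2 * N) ?T ?v"
    using v T delaunay_subdivision_eq_face_lattice[OF v]
    by (simp add: delaunay_realization_def inscribed_polytope_def labeled_polytope_def)
  moreover have "\<not> (delaunay_realization ?d (2 * N) ?T A \<and> coordinates_in F ?d (2 * N) A)" for A
    using not_realizable delaunay_vector_realization[OF K, of ?d "2 * N" A] coordinates[of ?d "2 * N" A]
    unfolding delaunay_realization_def by metis
  moreover have "\<not> (inscribed_realization ?d (2 * N) ?v w \<and> coordinates_in F ?d (2 * N) w)" for w
    using not_realizable polytope_vector_realization[OF K, of ?d "2 * N" w] coordinates[of ?d "2 * N" w]
    unfolding inscribed_realization_def inscribed_polytope_def T by metis
  moreover have "?d \<ge> 1" by simp
  ultimately show ?thesis using v by blast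
qed

end
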